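(* Let $d\ge2$ and $\epsilon\in[0,\frac12]$. For every $v\in C_0^\infty(\mathbb R^d)$, $$\lim_{s\nearrow1}\mathcal J^s_\epsilon(v)=\frac12\int_{\mathbb R^d}\langle\mathbb A_\epsilon(x)\nabla v(x),\nabla v(x)\rangle\,dx ,$$ where $\mathbb A_\epsilon(x)=(1-\epsilon)\mathrm{Id}+\epsilon\,\widehat x\otimes\widehat x$.
   Context: For $x\in\mathbb R^d\setminus\{0\}$ write $\widehat x=x/|x|$, $(\widehat x\otimes\widehat x)_{ij}=\widehat x_i\widehat x_j$. For $s\in(0,1)$, $$\mathcal J^s_\epsilon(v)=\frac{\kappa_{d,s}}2\int_{\mathbb R^d}\int_{\mathbb R^d}k_{s,\epsilon}(x,y)\,|v(x)-v(y)|^2\,dx\,dy,\qquad \kappa_{d,s}=\frac{2^{2s-1}\Gamma(\frac d2+s)}{\pi^{d/2}|\Gamma(-s)|},$$ $$k_{s,\epsilon}(x,y)=|x-y|^{-d-2s}\left\langle\tfrac{\mathbb A_{s,\epsilon}(x)+\mathbb A_{s,\epsilon}(y)}{2}\,\widehat{x-y},\widehat{x-y}\right\rangle,\qquad \mathbb A_{s,\epsilon}(x)=\left(1-\tfrac{1+2s}{2}\epsilon\right)\mathrm{Id}+\tfrac{d+2s}{2}\epsilon\,\widehat x\otimes\widehat x .$$ *)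

theory Defs
  imports "HOL-Analysis.Analysis"
begin

text \<open>\<^const>\<open>frechet_derivative\<close> is meaningful only where \<open>f\<close> is differentiable;
  \<open>C_k\<close> below demands this at every order. Continuity of \<open>f\<close> and of its lower-order
  derivatives follows from their differentiability.\<close>

definition partial_deriv :: "'d \<Rightarrow> (real ^ 'd \<Rightarrow> real) \<Rightarrow> real ^ 'd \<Rightarrow> real" where
  "partial_deriv i f x = frechet_derivative f (at x) (axis i 1)"

definition grad :: "(real ^ 'd \<Rightarrow> real) \<Rightarrow> real ^ 'd \<Rightarrow> real ^ 'd" where
  "grad f x = (\<chi> i. partial_deriv i f x)"

primrec C_k :: "nat \<Rightarrow> (real ^ 'd \<Rightarrow> real) \<Rightarrow> bool" where
  "C_k 0 f \<longleftrightarrow> continuous_on UNIV f"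
| "C_k (Suc k) f \<longleftrightarrow>
     f differentiable_on UNIV \<and> (\<forall>i. C_k k (partial_deriv i f))"

text \<open>Smooth functions with compact support, i.e. \<open>C\<^sub>0\<^sup>\<infinity>\<close> in the sense of test functions.\<close>

definition test_function :: "(real ^ 'd \<Rightarrow> real) \<Rightarrow> bool" where
  "test_function v \<longleftrightarrow> (\<forall>k. C_k k v) \<and> compact (closure {x. v x \<noteq> 0})"

text \<open>The unit vector \<open>x / |x|\<close> is \<^term>\<open>sgn x\<close>; it is \<open>0\<close> at \<open>x = 0\<close>. This convention only
  affects null sets in the integrals below.\<close>

definition hat_tensor :: "real ^ 'd \<Rightarrow> real ^ 'd ^ 'd" where
  "hat_tensor x = (\<chi> i j. sgn x $ i * sgn x $ j)"

definition A_frac :: "real \<Rightarrow> real \<Rightarrow> real ^ 'd \<Rightarrow> real ^ 'd ^ 'd" where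
  "A_frac s \<epsilon> x =
     (1 - (1 + 2 * s) / 2 * \<epsilon>) *\<^sub>R mat 1
     + ((real CARD('d) + 2 * s) / 2 * \<epsilon>) *\<^sub>R hat_tensor x"

definition A_loc :: "real \<Rightarrow> real ^ 'd \<Rightarrow> real ^ 'd ^ 'd" where
  "A_loc \<epsilon> x = (1 - \<epsilon>) *\<^sub>R mat 1 + \<epsilon> *\<^sub>R hat_tensor x"

definition k_frac :: "real \<Rightarrow> real \<Rightarrow> real ^ 'd \<Rightarrow> real ^ 'd \<Rightarrow> real" where
  "k_frac s \<epsilon> x y =
     norm (x - y) powr (- real CARD('d) - 2 * s)
     * ((((1 / 2) *\<^sub>R (A_frac s \<epsilon> x + A_frac s \<epsilon> y)) *v sgn (x - y)) \<bullet> sgn (x - y))"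

definition kappa :: "nat \<Rightarrow> real \<Rightarrow> real" where
  "kappa d s =
     2 powr (2 * s - 1) * Gamma (real d / 2 + s)
     / (pi powr (real d / 2) * \<bar>Gamma (- s)\<bar>)"

text \<open>The energy takes values in \<open>[0, \<infinity>]\<close>. For \<open>0 \<le> \<epsilon> \<le> 1 / 2\<close> and \<open>0 < s < 1\<close> the matrix
  \<^term>\<open>A_frac s \<epsilon> x\<close> is positive semidefinite, as \<open>(1 + 2 * s) / 2 * \<epsilon> < 1\<close>, so the kernel is
  nonnegative and \<^const>\<open>ennreal\<close> truncates nothing in this range.\<close>

definition J_frac :: "real \<Rightarrow> real \<Rightarrow> (real ^ 'd \<Rightarrow> real) \<Rightarrow> ennreal" where
  "J_frac s \<epsilon> v =
     ennreal (kappa CARD('d) s / 2)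
     * (\<integral>\<^sup>+ y. (\<integral>\<^sup>+ x. ennreal (k_frac s \<epsilon> x y * \<bar>v x - v y\<bar>\<^sup>2) \<partial>lborel) \<partial>lborel)"

end

theory Submission
  imports Defs
begin

text \<open>Substituting \<open>x = y + h\<close> and symmetrizing, the energy becomes the integral of
  \<open>|h|^(-d-2s) W(y,h) (v(y+h) - v(y))^2\<close> with a bounded weight \<open>W\<close> that depends on \<open>h\<close> only through
  its direction. Linearizing \<open>v\<close> for \<open>|h| \<le> 1\<close> and discarding \<open>|h| > 1\<close> costs an error that is
  bounded uniformly in \<open>s\<close>, hence vanishes after multiplication by \<open>kappa = O(1 - s)\<close>. The
  linearized integrand is homogeneous in \<open>h\<close>, so its integral over the unit ball is exactly
  \<open>d/(2-2s)\<close> times the unit-ball integral of its \<open>0\<close>-homogeneous angular part, a combination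
  of second and fourth moments that rotation invariance determines.\<close>

subsection \<open>Translations, dilations and rotations of Lebesgue measure\<close>

text \<open>Two effects cancel: the linearized energy blows up like \<open>1 / (1 - s)\<close>,
  while \<open>kappa\<close> decays like \<open>2 * (1 - s) / unit_ball_vol d\<close>. What is left
  is a moment computation, which also explains the coefficients of \<open>A_frac\<close>. For a unit
  vector \<open>q\<close>, the mean of \<open>(q \<bullet> sgn h)^2 * (p \<bullet> sgn h)^2\<close>
  over the ball is \<open>(|p|^2 + 2 * (q \<bullet> p)^2) / (d * (d + 2))\<close>, so the rank-one
  part leaks into the identity part of the limit. At \<open>s = 1\<close> the coefficients are
  \<open>1 - 3/2 * \<epsilon>\<close> and \<open>(d + 2)/2 * \<epsilon>\<close>; the leak adds
  \<open>\<epsilon>/2\<close> to the former, which gives \<open>1 - \<epsilon>\<close>, and the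
  latter leaves exactly \<open>\<epsilon>\<close>. Energies stay in \<open>ennreal\<close>, so
  Tonelli applies to the singular kernel without a prior integrability proof. A two-sided comparison
  with one error bound independent of \<open>s\<close> avoids taking a limit under the
  integral.\<close>

lemma set_cball_borel [measurable]: "cball (x :: 'a::euclidean_space) r \<in> sets borel"
  by simp

lemma nn_integral_lborel_translate:
  fixes f :: "'a::euclidean_space \<Rightarrow> ennreal"
  assumes [measurable]: "f \<in> borel_measurable borel"
  shows "(\<integral>\<^sup>+x. f (a + x) \<partial>lborel) = (\<integral>\<^sup>+x. f x \<partial>lborel)"
proof -
  have "(\<integral>\<^sup>+x. f x \<partial>lborel) = (\<integral>\<^sup>+x. f x \<partial>distr lborel borel ((+) a))"
    by (simp add: lborel_distr_plus)
  then show ?thesis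
    by (simp add: nn_integral_distr)
qed

lemma nn_integral_lborel_scaleR:
  fixes f :: "'a::euclidean_space \<Rightarrow> ennreal"
  assumes [measurable]: "f \<in> borel_measurable borel" and c: "c > 0"
  shows "(\<integral>\<^sup>+x. f x \<partial>lborel) = ennreal (c ^ DIM('a)) * (\<integral>\<^sup>+x. f (c *\<^sub>R x) \<partial>lborel)"
proof -
  have "(\<integral>\<^sup>+x. f x \<partial>lborel) =
      (\<integral>\<^sup>+x. f x \<partial>density (distr lborel borel (\<lambda>x. 0 + c *\<^sub>R x)) (\<lambda>_. \<bar>c\<bar> ^ DIM('a)))"
    using lborel_affine[of c "0::'a"] c by simp
  also have "\<dots> = (\<integral>\<^sup>+x. ennreal (c ^ DIM('a)) * f (c *\<^sub>R x) \<partial>lborel)"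
    using c by (simp add: nn_integral_density nn_integral_distr ennreal_power)
  finally show ?thesis
    by (simp add: nn_integral_cmult)
qed

lemma nn_integral_lborel_swap:
  fixes f :: "'a::euclidean_space \<Rightarrow> 'b::euclidean_space \<Rightarrow> ennreal"
  assumes "(\<lambda>(x, y). f x y) \<in> borel_measurable borel"
  shows "(\<integral>\<^sup>+x. \<integral>\<^sup>+y. f x y \<partial>lborel \<partial>lborel) = (\<integral>\<^sup>+y. \<integral>\<^sup>+x. f x y \<partial>lborel \<partial>lborel)"
proof -
  have "(\<lambda>(x, y). f x y) \<in> borel_measurable (lborel \<Otimes>\<^sub>M lborel)"
    using assms by (simp add: lborel_prod)
  from lborel_pair.Fubini'[OF this] show ?thesis by simp
qed

text \<open>Convolving \<open>g \<circ> f\<close> with the unit ball, which an orthogonal map preserves, reduces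
  rotation invariance to translation invariance.\<close>

lemma nn_integral_lborel_orthogonal:
  fixes f :: "'a::euclidean_space \<Rightarrow> 'a" and g :: "'a \<Rightarrow> ennreal"
  assumes f: "orthogonal_transformation f" and [measurable]: "g \<in> borel_measurable borel"
  shows "(\<integral>\<^sup>+x. g (f x) \<partial>lborel) = (\<integral>\<^sup>+x. g x \<partial>lborel)"
proof -
  have "linear f" using f by (rule orthogonal_transformation_linear)
  then have [measurable]: "f \<in> borel_measurable borel"
    by (intro borel_measurable_continuous_onI linear_continuous_on linear_conv_bounded_linear[THEN iffD1])
  \<comment> \<open>The ball volume enters as the total mass of the convolution weight; being
    neither zero nor infinite, it can be cancelled at the end.\<close>
  define V where "V = emeasure lborel (cball 0 1 :: 'a set)"
  have V: "V \<noteq> 0" "V \<noteq> \<infinity>"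
    by (auto simp: V_def emeasure_cball less_imp_neq[OF unit_ball_vol_pos, symmetric])
  \<comment> \<open>As \<open>f\<close> is onto, a shift of its values by \<open>y = f u\<close> is
    a shift of the argument by \<open>u\<close>.\<close>
  have inv: "(\<integral>\<^sup>+x. g (f x) \<partial>lborel) = (\<integral>\<^sup>+x. g (y + f x) \<partial>lborel)" for y
  proof -
    obtain u where u: "y = f u"
      using orthogonal_transformation_surj[OF f] by blast
    have "(\<integral>\<^sup>+x. g (y + f x) \<partial>lborel) = (\<integral>\<^sup>+x. g (f (u + x)) \<partial>lborel)"
      by (simp add: u linear_add[OF \<open>linear f\<close>])
    also have "\<dots> = (\<integral>\<^sup>+x. g (f x) \<partial>lborel)"
      by (rule nn_integral_lborel_translate) measurable
    finally show ?thesis by simp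
  qed
  have "V * (\<integral>\<^sup>+x. g (f x) \<partial>lborel) =
      (\<integral>\<^sup>+y. indicator (cball 0 1 :: 'a set) y * (\<integral>\<^sup>+x. g (f x) \<partial>lborel) \<partial>lborel)"
    unfolding V_def by (subst nn_integral_multc) auto
  also have "\<dots> = (\<integral>\<^sup>+y. \<integral>\<^sup>+x. indicator (cball 0 1) y * g (y + f x) \<partial>lborel \<partial>lborel)"
    by (simp add: nn_integral_cmult inv[symmetric])
  also have "\<dots> = (\<integral>\<^sup>+x. \<integral>\<^sup>+y. indicator (cball 0 1) y * g (y + f x) \<partial>lborel \<partial>lborel)"
    by (rule nn_integral_lborel_swap) (unfold split_beta borel_prod[symmetric], measurable)
  also have "\<dots> = (\<integral>\<^sup>+x. \<integral>\<^sup>+z. indicator (cball 0 1) (- f x + z) * g z \<partial>lborel \<partial>lborel)"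
  proof (rule nn_integral_cong)
    fix x
    show "(\<integral>\<^sup>+y. indicator (cball 0 1) y * g (y + f x) \<partial>lborel) =
        (\<integral>\<^sup>+z. indicator (cball 0 1) (- f x + z) * g z \<partial>lborel)"
      by (subst nn_integral_lborel_translate[of _ "- f x", symmetric]) (auto simp: algebra_simps)
  qed
  also have "\<dots> = (\<integral>\<^sup>+z. \<integral>\<^sup>+x. indicator (cball 0 1) (- f x + z) * g z \<partial>lborel \<partial>lborel)"
    by (rule nn_integral_lborel_swap) (unfold split_beta borel_prod[symmetric], measurable)
  also have "\<dots> = (\<integral>\<^sup>+z. V * g z \<partial>lborel)"
  proof (rule nn_integral_cong)
    fix z
    \<comment> \<open>Since \<open>f\<close> is an isometry, the ball condition says that
      \<open>x\<close> lies within distance 1 of the preimage \<open>u\<close> of \<open>z\<close>.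
      The inner integral is therefore a ball volume, independent of \<open>z\<close>.\<close>
    obtain u where u: "z = f u"
      using orthogonal_transformation_surj[OF f] by blast
    have "norm (- f x + z) = norm (u - x)" for x
      using orthogonal_transformation_norm[OF f, of "u - x"]
      by (simp add: u linear_diff[OF \<open>linear f\<close>])
    then have "indicator (cball 0 1) (- f x + z) = (indicator (cball u 1) x :: ennreal)" for x
      by (auto simp: indicator_def dist_norm norm_minus_commute)
    then show "(\<integral>\<^sup>+x. indicator (cball 0 1) (- f x + z) * g z \<partial>lborel) = V * g z"
      by (simp add: nn_integral_multc V_def emeasure_cball)
  qed
  also have "\<dots> = V * (\<integral>\<^sup>+x. g x \<partial>lborel)"
    by (simp add: nn_integral_cmult)
  finally show ?thesis
    using V by (simp add: ennreal_mult_cancel_left)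
qed

subsection \<open>Homogeneous functions on the unit ball\<close>

text \<open>This stands in for polar coordinates. A radial weight is a superposition of indicators
  of balls, with \<open>\<psi>\<close> as minus its derivative. By dilation, \<open>F\<close>
  integrated over the ball of radius \<open>t\<close> is \<open>t^d\<close> times its unit-ball
  integral, and Tonelli collects these factors in a one-dimensional integral.\<close>

lemma nn_integral_homogeneous_layer_cake:
  fixes F :: "'a::euclidean_space \<Rightarrow> ennreal" and \<psi> :: "real \<Rightarrow> ennreal"
  assumes [measurable]: "F \<in> borel_measurable borel" "\<psi> \<in> borel_measurable borel"
    and hom: "\<And>t h. t > 0 \<Longrightarrow> F (t *\<^sub>R h) = F h"
  shows "(\<integral>\<^sup>+h. F h * (\<integral>\<^sup>+t. \<psi> t * indicator {norm h..} t \<partial>lborel) \<partial>lborel) =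
    (\<integral>\<^sup>+h. F h * indicator (cball 0 1) h \<partial>lborel) *
    (\<integral>\<^sup>+t. ennreal (t ^ DIM('a)) * \<psi> t * indicator {0<..} t \<partial>lborel)"
proof -
  define M where "M = (\<integral>\<^sup>+h. F h * indicator (cball 0 1) h \<partial>lborel)"
  have scale: "(\<integral>\<^sup>+h. F h * indicator (cball 0 t) h \<partial>lborel) = ennreal (t ^ DIM('a)) * M" if "t > 0" for t
  proof -
    have "(\<integral>\<^sup>+h. F h * indicator (cball 0 t) h \<partial>lborel) =
      ennreal (t ^ DIM('a)) * (\<integral>\<^sup>+h. F (t *\<^sub>R h) * indicator (cball 0 t) (t *\<^sub>R h) \<partial>lborel)"
      using that by (intro nn_integral_lborel_scaleR) auto
    also have "(\<integral>\<^sup>+h. F (t *\<^sub>R h) * indicator (cball 0 t) (t *\<^sub>R h) \<partial>lborel) = M"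
      unfolding M_def using that by (intro nn_integral_cong) (auto simp: hom indicator_def)
    finally show ?thesis .
  qed
  have [measurable]: "Measurable.pred (borel \<Otimes>\<^sub>M borel) (\<lambda>p::'a \<times> real. snd p \<in> {norm (fst p)..})"
    by (simp add: atLeast_def)
  have "(\<integral>\<^sup>+h. F h * (\<integral>\<^sup>+t. \<psi> t * indicator {norm h..} t \<partial>lborel) \<partial>lborel) =
      (\<integral>\<^sup>+h. \<integral>\<^sup>+t. F h * (\<psi> t * indicator {norm h..} t) \<partial>lborel \<partial>lborel)"
    by (simp add: nn_integral_cmult)
  also have "\<dots> = (\<integral>\<^sup>+t. \<integral>\<^sup>+h. F h * (\<psi> t * indicator {norm h..} t) \<partial>lborel \<partial>lborel)"
    by (rule nn_integral_lborel_swap) (unfold split_beta borel_prod[symmetric], measurable)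
  also have "\<dots> = (\<integral>\<^sup>+t. M * (ennreal (t ^ DIM('a)) * \<psi> t * indicator {0<..} t) \<partial>lborel)"
  proof (rule nn_integral_cong_AE)
    \<comment> \<open>Radius 0 is excluded because its ball is a point, which \<open>scale\<close>
      does not cover; for negative \<open>t\<close> the ball is empty and both sides are 0.\<close>
    have "AE t in lborel. t \<noteq> (0::real)"
      by (rule AE_lborel_singleton)
    then show "AE t in lborel. (\<integral>\<^sup>+h. F h * (\<psi> t * indicator {norm h..} t) \<partial>lborel) =
        M * (ennreal (t ^ DIM('a)) * \<psi> t * indicator {0<..} t)"
    proof eventually_elim
      case (elim t)
      have "(\<integral>\<^sup>+h. F h * (\<psi> t * indicator {norm h..} t) \<partial>lborel) =
          (\<integral>\<^sup>+h. F h * indicator (cball 0 t) h * \<psi> t \<partial>lborel)"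
        by (intro nn_integral_cong) (auto simp: indicator_def)
      also have "\<dots> = (\<integral>\<^sup>+h. F h * indicator (cball 0 t) h \<partial>lborel) * \<psi> t"
        by (simp add: nn_integral_multc)
      also have "\<dots> = M * (ennreal (t ^ DIM('a)) * \<psi> t * indicator {0<..} t)"
      proof (cases "t > 0")
        case True
        then show ?thesis by (simp add: scale mult_ac)
      next
        case False
        then have "cball 0 t = ({} :: 'a set)" using elim by simp
        then show ?thesis using False by simp
      qed
      finally show ?case .
    qed
  qed
  also have "\<dots> = M * (\<integral>\<^sup>+t. ennreal (t ^ DIM('a)) * \<psi> t * indicator {0<..} t \<partial>lborel)"
    by (simp add: nn_integral_cmult)
  finally show ?thesis by (simp add: M_def)
qed

text \<open>The weight \<open>r^-\<alpha>\<close> cut off at radius 1 jumps there. For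
  \<open>0 < r \<le> 1\<close> it equals 1 plus the integral of
  \<open>\<alpha> * t^(-\<alpha> - 1)\<close> from \<open>r\<close> to 1. The 1 contributes the
  plain ball integral, the layers contribute \<open>\<alpha> / (d - \<alpha>)\<close> times it, and
  the sum is \<open>d / (d - \<alpha>)\<close>.\<close>

lemma nn_integral_homogeneous_powr_cball:
  fixes F :: "'a::euclidean_space \<Rightarrow> ennreal" and \<alpha> :: real
  assumes [measurable]: "F \<in> borel_measurable borel"
    and hom: "\<And>t h. t > 0 \<Longrightarrow> F (t *\<^sub>R h) = F h"
    and \<alpha>: "0 < \<alpha>" "\<alpha> < real DIM('a)"
  shows "(\<integral>\<^sup>+h. F h * ennreal (norm h powr - \<alpha>) * indicator (cball 0 1) h \<partial>lborel) =
    ennreal (DIM('a) / (DIM('a) - \<alpha>)) * (\<integral>\<^sup>+h. F h * indicator (cball 0 1) h \<partial>lborel)"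
    (is "?L = _ * ?M")
proof -
  define \<psi> where "\<psi> t = ennreal (\<alpha> * t powr (- \<alpha> - 1)) * indicator {0<..1} t" for t
  have [measurable]: "\<psi> \<in> borel_measurable borel"
    unfolding \<psi>_def by measurable
  have [measurable]: "Measurable.pred (borel \<Otimes>\<^sub>M borel) (\<lambda>p::'a \<times> real. snd p \<in> {norm (fst p)..})"
    by (simp add: atLeast_def)
  have layer: "(\<integral>\<^sup>+t. \<psi> t * indicator {norm h..} t \<partial>lborel) =
      ennreal (norm h powr - \<alpha> - 1) * indicator (cball 0 1) h" if "h \<noteq> 0" for h :: 'a
  proof (cases "norm h \<le> 1")
    case True
    have "(\<integral>\<^sup>+t. \<psi> t * indicator {norm h..} t \<partial>lborel) =
        (\<integral>\<^sup>+t. ennreal (\<alpha> * t powr (- \<alpha> - 1)) * indicator {norm h..1} t \<partial>lborel)"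
      by (intro nn_integral_cong)
        (auto simp: \<psi>_def indicator_def dest: less_le_trans[OF zero_less_norm_iff[THEN iffD2, OF that]])
    also have "\<dots> = ennreal (- (1 powr - \<alpha>) - - (norm h powr - \<alpha>))"
    proof (rule nn_integral_FTC_Icc)
      show "((\<lambda>t. - (t powr - \<alpha>)) has_real_derivative \<alpha> * x powr (- \<alpha> - 1)) (at x)"
        if "x \<in> {norm h..1}" for x
      proof -
        have "x > 0" using \<open>h \<noteq> 0\<close> that by (auto intro: less_le_trans[of 0 "norm h" x])
        then show ?thesis by (auto intro!: derivative_eq_intros)
      qed
    qed (use True \<alpha> in auto)
    finally show ?thesis using True by simp
  next
    case False
    then have "\<psi> t * indicator {norm h..} t = 0" for t
      by (auto simp: \<psi>_def indicator_def)
    then show ?thesis using False by (simp only:) simp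
  qed
  have "?L = (\<integral>\<^sup>+h. F h * indicator (cball 0 1) h + F h * (\<integral>\<^sup>+t. \<psi> t * indicator {norm h..} t \<partial>lborel) \<partial>lborel)"
  proof (rule nn_integral_cong_AE)
    show "AE h in lborel. F h * ennreal (norm h powr - \<alpha>) * indicator (cball 0 1) h =
        F h * indicator (cball 0 1) h + F h * (\<integral>\<^sup>+t. \<psi> t * indicator {norm h..} t \<partial>lborel)"
    proof (rule eventually_mono[OF AE_lborel_singleton[of 0]])
      fix h :: 'a
      assume elim: "h \<noteq> 0"
      have "1 \<le> norm h powr - \<alpha>" if "norm h \<le> 1"
        using that elim \<alpha> by (simp add: powr_minus_divide powr_le_one_le powr_le1)
      then have "ennreal (norm h powr - \<alpha>) = 1 + ennreal (norm h powr - \<alpha> - 1)" if "norm h \<le> 1"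
        using that by (simp flip: ennreal_1 ennreal_plus)
      then show "F h * ennreal (norm h powr - \<alpha>) * indicator (cball 0 1) h =
          F h * indicator (cball 0 1) h + F h * (\<integral>\<^sup>+t. \<psi> t * indicator {norm h..} t \<partial>lborel)"
        unfolding layer[OF elim] by (auto simp: indicator_def distrib_left)
    qed
  qed
  also have "\<dots> = ?M + (\<integral>\<^sup>+h. F h * (\<integral>\<^sup>+t. \<psi> t * indicator {norm h..} t \<partial>lborel) \<partial>lborel)"
    by (rule nn_integral_add) measurable
  also have "(\<integral>\<^sup>+h. F h * (\<integral>\<^sup>+t. \<psi> t * indicator {norm h..} t \<partial>lborel) \<partial>lborel) =
      ?M * (\<integral>\<^sup>+t. ennreal (t ^ DIM('a)) * \<psi> t * indicator {0<..} t \<partial>lborel)"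
    by (rule nn_integral_homogeneous_layer_cake) (auto simp: hom)
  also have "(\<integral>\<^sup>+t. ennreal (t ^ DIM('a)) * \<psi> t * indicator {0<..} t \<partial>lborel) =
      (\<integral>\<^sup>+t. ennreal (\<alpha> * t powr (DIM('a) - \<alpha> - 1)) * indicator {0..1} t \<partial>lborel)"
  proof (rule nn_integral_cong_AE)
    have "AE t in lborel. t \<noteq> (0::real)"
      by (rule AE_lborel_singleton)
    then show "AE t in lborel. ennreal (t ^ DIM('a)) * \<psi> t * indicator {0<..} t =
       ennreal (\<alpha> * t powr (DIM('a) - \<alpha> - 1)) * indicator {0..1} t"
    proof eventually_elim
      case (elim t)
      have "t ^ DIM('a) * (\<alpha> * t powr (- \<alpha> - 1)) = \<alpha> * t powr (DIM('a) - \<alpha> - 1)" if "t > 0"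
        using that by (simp add: powr_realpow[symmetric] powr_add[symmetric] algebra_simps)
      then show ?case
        using elim \<alpha> by (auto simp: \<psi>_def indicator_def simp flip: ennreal_mult)
    qed
  qed
  also have "\<dots> = ennreal (\<alpha> * (1 powr (DIM('a) - \<alpha> - 1 + 1) / (DIM('a) - \<alpha> - 1 + 1)))"
    using \<alpha> by (intro nn_integral_has_integral_lebesgue' has_integral_mult_right has_integral_powr_from_0) auto
  also have "?M + ?M * \<dots> = (1 + ennreal (\<alpha> / (DIM('a) - \<alpha>))) * ?M"
    by (simp add: algebra_simps)
  also have "1 + ennreal (\<alpha> / (DIM('a) - \<alpha>)) = ennreal (1 + \<alpha> / (DIM('a) - \<alpha>))"
    using \<alpha> by simp
  also have "1 + \<alpha> / (DIM('a) - \<alpha>) = DIM('a) / (DIM('a) - \<alpha>)"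
    using \<alpha> by (simp add: field_simps)
  finally show ?thesis .
qed

lemma nn_integral_powr_outside_cball_finite:
  "(\<integral>\<^sup>+(h::'a::euclidean_space). ennreal (norm h powr - (real DIM('a) + 1)) * indicator (- cball 0 1) h \<partial>lborel) < \<infinity>"
    (is "?L < _")
proof -
  define \<beta> where "\<beta> = real DIM('a) + 1"
  have \<beta>: "\<beta> > 0" by (simp add: \<beta>_def)
  \<comment> \<open>Layers below radius 1 are left out. Inside the unit ball the layered weight is
    then the constant 1, which is harmless for an upper bound, and \<open>\<beta> = d + 1\<close>
    leaves the integrand \<open>\<beta> * t^-2\<close>, integrable at infinity.\<close>
  define \<psi> where "\<psi> t = ennreal (\<beta> * t powr (- \<beta> - 1)) * indicator {1..} t" for t
  have [measurable]: "\<psi> \<in> borel_measurable borel"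
    unfolding \<psi>_def by measurable
  have layer: "(\<integral>\<^sup>+t. \<psi> t * indicator {norm h..} t \<partial>lborel) = ennreal (norm h powr - \<beta>)"
    if "norm h > 1" for h :: 'a
  proof -
    have "(\<integral>\<^sup>+t. \<psi> t * indicator {norm h..} t \<partial>lborel) =
        (\<integral>\<^sup>+t. ennreal (\<beta> * t powr (- \<beta> - 1)) * indicator {norm h..} t \<partial>lborel)"
      using that by (intro nn_integral_cong) (auto simp: \<psi>_def indicator_def)
    also have "\<dots> = ennreal (\<beta> * (- (norm h powr (- \<beta> - 1 + 1)) / (- \<beta> - 1 + 1)))"
      using \<beta> that
      by (intro nn_integral_has_integral_lebesgue' has_integral_mult_right has_integral_powr_to_inf) auto
    finally show ?thesis using \<beta> by simp
  qed
  have "?L \<le> (\<integral>\<^sup>+(h::'a). 1 * (\<integral>\<^sup>+t. \<psi> t * indicator {norm h..} t \<partial>lborel) \<partial>lborel)"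
  proof (rule nn_integral_mono)
    fix h :: 'a
    show "ennreal (norm h powr - (real DIM('a) + 1)) * indicator (- cball 0 1) h \<le>
        1 * (\<integral>\<^sup>+t. \<psi> t * indicator {norm h..} t \<partial>lborel)"
      using layer[of h] by (cases "norm h > 1") (simp_all add: \<beta>_def add.commute)
  qed
  also have "\<dots> = (\<integral>\<^sup>+(h::'a). 1 * indicator (cball 0 1) h \<partial>lborel) *
      (\<integral>\<^sup>+t. ennreal (t ^ DIM('a)) * \<psi> t * indicator {0<..} t \<partial>lborel)"
    by (rule nn_integral_homogeneous_layer_cake) auto
  also have "(\<integral>\<^sup>+(h::'a). 1 * indicator (cball 0 1) h \<partial>lborel) = ennreal (unit_ball_vol DIM('a))"
    by (simp add: emeasure_cball)
  also have "(\<integral>\<^sup>+t. ennreal (t ^ DIM('a)) * \<psi> t * indicator {0<..} t \<partial>lborel) =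
      (\<integral>\<^sup>+t. ennreal (\<beta> * t powr - 2) * indicator {1..} t \<partial>lborel)"
  proof (rule nn_integral_cong)
    fix t :: real
    have "t ^ DIM('a) * (\<beta> * t powr (- \<beta> - 1)) = \<beta> * t powr - 2" if "t > 0"
      using that by (simp add: powr_realpow[symmetric] powr_add[symmetric] \<beta>_def)
    then show "ennreal (t ^ DIM('a)) * \<psi> t * indicator {0<..} t =
        ennreal (\<beta> * t powr - 2) * indicator {1..} t"
      using \<beta> by (auto simp: \<psi>_def indicator_def simp flip: ennreal_mult)
  qed
  also have "\<dots> = ennreal (\<beta> * (- (1 powr (- 2 + 1)) / (- 2 + 1)))"
    using \<beta> by (intro nn_integral_has_integral_lebesgue' has_integral_mult_right has_integral_powr_to_inf) auto
  finally show ?thesis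
    by (auto simp: ennreal_mult_less_top intro: le_less_trans)
qed

subsection \<open>Angular moments\<close>

lemma borel_measurable_sgn_vec [measurable]:
  "(sgn :: 'a::euclidean_space \<Rightarrow> 'a) \<in> borel_measurable borel"
  unfolding sgn_div_norm by measurable

lemma inner_sgn_sq_le: "(p \<bullet> sgn h)\<^sup>2 \<le> (norm p)\<^sup>2" for p h :: "'a::real_inner"
proof -
  have "\<bar>p \<bullet> sgn h\<bar> \<le> norm p * norm (sgn h)"
    by (rule Cauchy_Schwarz_ineq2)
  also have "\<dots> \<le> norm p"
    by (simp add: norm_sgn)
  finally show ?thesis
    by (simp add: abs_le_square_iff[symmetric])
qed

lemma sum_Basis_inner_sq: "(\<Sum>b\<in>Basis. (p \<bullet> b)\<^sup>2) = (norm p)\<^sup>2" for p :: "'a::euclidean_space"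
  unfolding power2_norm_eq_inner euclidean_inner[of p p] by (simp add: power2_eq_square)

lemma integrable_indicator_cball_bounded:
  fixes f :: "'a::euclidean_space \<Rightarrow> real"
  assumes "f \<in> borel_measurable borel" "\<And>x. \<bar>f x\<bar> \<le> K"
  shows "integrable lborel (\<lambda>x. indicator (cball 0 r) x * f x)"
proof -
  have "integrable lborel (\<lambda>x. indicator (cball 0 r) x *\<^sub>R f x)"
    using assms emeasure_lborel_cball_finite[of "0::'a" r]
    by (intro integrableI_bounded_set_indicator[where B = K]) auto
  then show ?thesis by simp
qed

lemma integrable_moment_cball [simp]:
  "integrable lborel (\<lambda>h. indicator (cball 0 1) h * ((p \<bullet> sgn h)\<^sup>2 * (q \<bullet> sgn h)\<^sup>2))"
  "integrable lborel (\<lambda>h. indicator (cball 0 1) h * (p \<bullet> sgn h) ^ 4)"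
  "integrable lborel (\<lambda>h. indicator (cball 0 1) h * (p \<bullet> sgn h)\<^sup>2)"
  for p q :: "'a::euclidean_space"
proof -
  have *: "(p \<bullet> sgn h)\<^sup>2 * (q \<bullet> sgn h)\<^sup>2 \<le> (norm p)\<^sup>2 * (norm q)\<^sup>2" for p q h :: 'a
    by (intro mult_mono inner_sgn_sq_le) auto
  show "integrable lborel (\<lambda>h. indicator (cball 0 1) h * ((p \<bullet> sgn h)\<^sup>2 * (q \<bullet> sgn h)\<^sup>2))"
    by (rule integrable_indicator_cball_bounded[where K = "(norm p)\<^sup>2 * (norm q)\<^sup>2"]) (measurable, simp add: *)
  have "(p \<bullet> sgn h) ^ 4 \<le> norm p ^ 4" for h
    using *[of p h p] by (simp flip: power_add)
  then show "integrable lborel (\<lambda>h. indicator (cball 0 1) h * (p \<bullet> sgn h) ^ 4)"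
    by (intro integrable_indicator_cball_bounded[where K = "norm p ^ 4"]) simp_all
  show "integrable lborel (\<lambda>h. indicator (cball 0 1) h * (p \<bullet> sgn h)\<^sup>2)"
    by (rule integrable_indicator_cball_bounded[where K = "(norm p)\<^sup>2"]) (measurable, simp add: inner_sgn_sq_le)
qed

text \<open>An orthogonal map carrying \<open>p\<close> to \<open>q\<close> commutes with
  \<open>sgn\<close> and preserves the ball, so it transports one integral to the other. The
  argument passes through nonnegative integrals, for which rotation invariance is available.\<close>

lemma fourth_moment_cball_rotate:
  fixes p q :: "real ^ 'n"
  assumes "norm p = norm q"
  shows "(\<integral>h. indicator (cball 0 1) h * (p \<bullet> sgn h) ^ 4 \<partial>lborel) =
    (\<integral>h. indicator (cball 0 1) h * (q \<bullet> sgn h) ^ 4 \<partial>lborel)"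
proof -
  obtain f where f: "orthogonal_transformation f" "f p = q"
    using orthogonal_transformation_exists[OF assms] by blast
  have "linear f" using f by (simp add: orthogonal_transformation_linear)
  have "q \<bullet> sgn (f h) = p \<bullet> sgn h" for h
  proof -
    have "q \<bullet> sgn (f h) = f p \<bullet> f (sgn h)"
      using f \<open>linear f\<close> by (simp add: sgn_div_norm orthogonal_transformation_norm linear_scale)
    also have "\<dots> = p \<bullet> sgn h"
      using f(1) by (simp add: orthogonal_transformation_def)
    finally show ?thesis .
  qed
  then have "(\<integral>\<^sup>+h. ennreal (indicator (cball 0 1) h * (p \<bullet> sgn h) ^ 4) \<partial>lborel) =
     (\<integral>\<^sup>+h. ennreal (indicator (cball 0 1) (f h) * (q \<bullet> sgn (f h)) ^ 4) \<partial>lborel)"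
    using f by (auto intro!: nn_integral_cong simp: indicator_def orthogonal_transformation_norm)
  also have "\<dots> = (\<integral>\<^sup>+h. ennreal (indicator (cball 0 1) h * (q \<bullet> sgn h) ^ 4) \<partial>lborel)"
    by (rule nn_integral_lborel_orthogonal[OF f(1)]) measurable
  finally show ?thesis
    by (simp add: integral_eq_nn_integral)
qed

text \<open>Rotation invariance determines the fourth moment up to a constant, polarization yields the
  mixed moments, and summing these over an orthonormal basis identifies the constant.\<close>

lemma mixed_moment_cball:
  fixes p q :: "real ^ 'n"
  defines "c \<equiv> unit_ball_vol (real CARD('n)) / (real CARD('n) * (real CARD('n) + 2))"
  shows "(\<integral>h. indicator (cball 0 1) h * ((p \<bullet> sgn h)\<^sup>2 * (q \<bullet> sgn h)\<^sup>2) \<partial>lborel) =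
      c * ((norm p)\<^sup>2 * (norm q)\<^sup>2 + 2 * (p \<bullet> q)\<^sup>2)" (is ?mixed)
    and "(\<integral>h. indicator (cball 0 1) h * (p \<bullet> sgn h)\<^sup>2 \<partial>lborel) =
      c * (real CARD('n) + 2) * (norm p)\<^sup>2" (is ?second)
proof -
  let ?I = "\<lambda>f::real ^ 'n \<Rightarrow> real. \<integral>h. indicator (cball 0 1) h * f h \<partial>lborel"
  \<comment> \<open>\<open>undefined\<close> serves as an arbitrary index: by rotation invariance
    every unit vector yields the same constant.\<close>
  define a where "a = ?I (\<lambda>h. (axis undefined 1 \<bullet> sgn h) ^ 4)"
  have fourth: "?I (\<lambda>h. (p \<bullet> sgn h) ^ 4) = a * ((norm p)\<^sup>2)\<^sup>2" for p
  proof -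
    have "?I (\<lambda>h. (p \<bullet> sgn h) ^ 4) = ?I (\<lambda>h. ((norm p *\<^sub>R axis undefined 1) \<bullet> sgn h) ^ 4)"
      by (rule fourth_moment_cball_rotate) simp
    also have "\<dots> = ?I (\<lambda>h. norm p ^ 4 * (axis undefined 1 \<bullet> sgn h) ^ 4)"
      by (simp add: power_mult_distrib)
    also have "\<dots> = a * norm p ^ 4"
      unfolding a_def mult.left_commute[of _ "norm p ^ 4"] by simp
    finally show ?thesis by simp
  qed
  have mixed: "?I (\<lambda>h. (p \<bullet> sgn h)\<^sup>2 * (q \<bullet> sgn h)\<^sup>2) =
      a / 3 * ((norm p)\<^sup>2 * (norm q)\<^sup>2 + 2 * (p \<bullet> q)\<^sup>2)" for p q
  proof -
    let ?F = "\<lambda>p h. indicator (cball 0 1) h * (p \<bullet> sgn h) ^ 4 :: real"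
    \<comment> \<open>Polarization:
      \<open>(u + w)^4 + (u - w)^4 - 2 * u^4 - 2 * w^4 = 12 * u^2 * w^2\<close>.\<close>
    have "12 * ?I (\<lambda>h. (p \<bullet> sgn h)\<^sup>2 * (q \<bullet> sgn h)\<^sup>2) =
        (\<integral>h. ?F (p + q) h + ?F (p - q) h - 2 * ?F p h - 2 * ?F q h \<partial>lborel)"
      unfolding integral_mult_right_zero[symmetric]
      by (rule Bochner_Integration.integral_cong)
        (auto simp: algebra_simps inner_add_left inner_diff_left power2_eq_square power4_eq_xxxx)
    also have "\<dots> = a * ((norm (p + q))\<^sup>2)\<^sup>2 + a * ((norm (p - q))\<^sup>2)\<^sup>2
        - 2 * (a * ((norm p)\<^sup>2)\<^sup>2) - 2 * (a * ((norm q)\<^sup>2)\<^sup>2)"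
      unfolding fourth[symmetric] by simp
    also have "(norm (p + q))\<^sup>2 = (norm p)\<^sup>2 + (norm q)\<^sup>2 + 2 * (p \<bullet> q)"
      by (simp add: power2_norm_eq_inner inner_add_left inner_add_right inner_commute)
    also have "(norm (p - q))\<^sup>2 = (norm p)\<^sup>2 + (norm q)\<^sup>2 - 2 * (p \<bullet> q)"
      by (simp add: power2_norm_eq_inner inner_diff_left inner_diff_right inner_commute)
    finally show ?thesis
      by (simp add: power2_eq_square algebra_simps)
  qed
  have second: "?I (\<lambda>h. (p \<bullet> sgn h)\<^sup>2) = a / 3 * (real CARD('n) + 2) * (norm p)\<^sup>2" for p
  proof -
    \<comment> \<open>The squared coordinates of \<open>sgn h\<close> sum to 1 for
      \<open>h \<noteq> 0\<close>, and for \<open>h = 0\<close> the prefactor vanishes. Inserting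
      this sum reduces the second moment to mixed ones.\<close>
    have "(p \<bullet> sgn h)\<^sup>2 * (\<Sum>b\<in>Basis. (b \<bullet> sgn h)\<^sup>2) = (p \<bullet> sgn h)\<^sup>2" for h
      using sum_Basis_inner_sq[of "sgn h"]
      by (cases "h = 0") (simp_all add: inner_commute norm_sgn)
    then have "?I (\<lambda>h. (p \<bullet> sgn h)\<^sup>2) =
       (\<integral>h. (\<Sum>b\<in>Basis. indicator (cball 0 1) h * ((p \<bullet> sgn h)\<^sup>2 * (b \<bullet> sgn h)\<^sup>2)) \<partial>lborel)"
      by (simp only: sum_distrib_left[symmetric])
    also have "\<dots> = (\<Sum>b\<in>Basis. ?I (\<lambda>h. (p \<bullet> sgn h)\<^sup>2 * (b \<bullet> sgn h)\<^sup>2))"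
      by (rule Bochner_Integration.integral_sum) simp
    also have "\<dots> = (\<Sum>b\<in>Basis. a / 3 * ((norm p)\<^sup>2 + 2 * (p \<bullet> b)\<^sup>2))"
      by (intro sum.cong) (simp_all add: mixed)
    also have "\<dots> = a / 3 * (CARD('n) * (norm p)\<^sup>2 + 2 * (norm p)\<^sup>2)"
      by (simp only: sum_distrib_left[symmetric] sum.distrib sum_Basis_inner_sq) simp
    finally show ?thesis by (simp add: algebra_simps)
  qed
  \<comment> \<open>The trace of the second moment is the ball volume, and this fixes
    \<open>a / 3\<close>. Here no prefactor vanishes at \<open>h = 0\<close>, so that point is
    discarded as a null set.\<close>
  have "unit_ball_vol CARD('n) = ?I (\<lambda>h. 1)"
    using content_cball[of 1 "0::real ^ 'n"] by simp
  also have "\<dots> = ?I (\<lambda>h. \<Sum>b\<in>Basis. (b \<bullet> sgn h)\<^sup>2)"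
  proof (rule integral_cong_AE)
    have "AE h in lborel. h \<noteq> (0::real ^ 'n)"
      by (rule AE_lborel_singleton)
    then show "AE h in lborel. indicator (cball 0 1) h * (1::real) =
        indicator (cball 0 1) h * (\<Sum>b\<in>Basis. (b \<bullet> sgn (h::real ^ 'n))\<^sup>2)"
    proof eventually_elim
      case (elim h)
      then show ?case
        using sum_Basis_inner_sq[of "sgn h"] by (simp add: inner_commute norm_sgn)
    qed
  qed auto
  also have "\<dots> = (\<Sum>b\<in>Basis. ?I (\<lambda>h. (b \<bullet> sgn h)\<^sup>2))"
    by (simp only: sum_distrib_left) (rule Bochner_Integration.integral_sum, simp)
  also have "\<dots> = a / 3 * (real CARD('n) + 2) * real CARD('n)"
    by (simp add: second)
  finally have "unit_ball_vol CARD('n) = a / 3 * (real CARD('n) * (real CARD('n) + 2))"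
    by (simp add: mult_ac)
  moreover have "real CARD('n) * (real CARD('n) + 2) \<noteq> 0"
    by (auto simp: add_eq_0_iff)
  ultimately have "a / 3 = c"
    unfolding c_def by (metis nonzero_mult_div_cancel_right)
  then show ?mixed ?second
    using mixed second by simp_all
qed

subsection \<open>Bounds for test functions\<close>

lemma has_derivative_grad:
  fixes f :: "real ^ 'd \<Rightarrow> real"
  assumes "f differentiable at x"
  shows "(f has_derivative (\<lambda>h. grad f x \<bullet> h)) (at x)"
proof -
  let ?f' = "frechet_derivative f (at x)"
  have f': "(f has_derivative ?f') (at x)"
    using assms by (simp add: frechet_derivative_works)
  then have lin: "linear ?f'"
    by (rule has_derivative_linear)
  have "?f' h = grad f x \<bullet> h" for h
  proof -
    have "?f' h = ?f' (\<Sum>i\<in>UNIV. h $ i *\<^sub>R axis i 1)"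
      using basis_expansion[of h] by (simp add: scalar_mult_eq_scaleR)
    also have "\<dots> = (\<Sum>i\<in>UNIV. h $ i * ?f' (axis i 1))"
      by (simp add: linear_sum[OF lin] linear_scale[OF lin])
    finally show ?thesis
      by (simp add: grad_def partial_deriv_def inner_vec_def mult.commute)
  qed
  then have "?f' = (\<lambda>h. grad f x \<bullet> h)"
    by (rule ext)
  then show ?thesis
    using f' by simp
qed

lemma partial_deriv_eq_0_outside:
  assumes "\<And>x. norm x > R \<Longrightarrow> f x = 0" "norm x > R"
  shows "partial_deriv i f x = 0"
proof -
  have "open {x::real ^ 'd. R < norm x}"
    by (intro open_Collect_less continuous_intros)
  then have "(f has_derivative (\<lambda>_. 0)) (at x)"
    using assms
    by (intro has_derivative_transform_within_open[of "\<lambda>_. 0" "\<lambda>_. 0" x UNIV "{x. norm x > R}" f]) auto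
  then show ?thesis
    unfolding partial_deriv_def by (simp flip: frechet_derivative_at)
qed

lemma bounded_if_eq_0_outside:
  fixes g :: "'a::euclidean_space \<Rightarrow> 'b::real_normed_vector"
  assumes "continuous_on UNIV g" "\<And>x. norm x > R \<Longrightarrow> g x = 0"
  obtains K where "K \<ge> 0" "\<And>x. norm (g x) \<le> K"
proof -
  have "bounded (g ` cball 0 R)"
    using assms(1) by (intro compact_imp_bounded compact_continuous_image) (auto intro: continuous_on_subset)
  then obtain K where K: "\<And>x. norm x \<le> R \<Longrightarrow> norm (g x) \<le> K"
    by (metis bounded_iff image_eqI mem_cball_0)
  have "norm (g x) \<le> max K 0" for x
    using K[of x] assms(2)[of x] by (cases "norm x \<le> R") auto
  then show ?thesis
    using that[of "max K 0"] by auto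
qed

text \<open>Vanishing outside a ball makes the continuous gradient globally bounded, and the mean
  value inequality turns this bound into a Lipschitz constant.\<close>

lemma C_1_Lipschitz:
  fixes f :: "real ^ 'd \<Rightarrow> real"
  assumes "C_k 1 f" "\<And>x. norm x > R \<Longrightarrow> f x = 0"
  obtains L where "L \<ge> 0" "\<And>x. norm (grad f x) \<le> L" "\<And>x y. \<bar>f x - f y\<bar> \<le> L * norm (x - y)"
proof -
  have "continuous_on UNIV (grad f)"
    using assms(1) unfolding grad_def[abs_def] by (intro continuous_on_vec_lambda) simp
  moreover have "grad f x = 0" if "norm x > R" for x
    using partial_deriv_eq_0_outside[OF assms(2) that] by (simp add: grad_def vec_eq_iff)
  ultimately obtain L where L: "L \<ge> 0" "\<And>x. norm (grad f x) \<le> L"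
    using bounded_if_eq_0_outside[of "grad f" R] by blast
  have "norm (f x - f y) \<le> L * norm (x - y)" for x y
  proof (rule differentiable_bound)
    show "(f has_derivative (\<lambda>h. grad f z \<bullet> h)) (at z within UNIV)" for z
      using assms(1) by (intro has_derivative_grad) (auto simp: differentiable_on_def)
    show "onorm (\<lambda>h. grad f z \<bullet> h) \<le> L" for z
    proof (rule onorm_bound)
      show "norm (grad f z \<bullet> h) \<le> L * norm h" for h
        using Cauchy_Schwarz_ineq2[of "grad f z" h] mult_right_mono[OF L(2)[of z] norm_ge_zero[of h]] by simp
    qed (rule L(1))
  qed auto
  then show ?thesis
    using that L by auto
qed

text \<open>Each partial derivative is again C1 and vanishes far out, so
  \<open>C_1_Lipschitz\<close> applies componentwise; bounding the norm by the sum of absolute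
  components adds up the constants.\<close>

lemma C_2_grad_Lipschitz:
  fixes f :: "real ^ 'd \<Rightarrow> real"
  assumes "C_k 2 f" "\<And>x. norm x > R \<Longrightarrow> f x = 0"
  obtains L where "L \<ge> 0" "\<And>x y. norm (grad f x - grad f y) \<le> L * norm (x - y)"
proof -
  have "\<exists>L\<ge>0. \<forall>x y. \<bar>partial_deriv i f x - partial_deriv i f y\<bar> \<le> L * norm (x - y)" for i
  proof -
    have "C_k 1 (partial_deriv i f)"
      using assms(1) by (simp add: numeral_2_eq_2)
    moreover have "partial_deriv i f x = 0" if "norm x > R" for x
      using partial_deriv_eq_0_outside[OF assms(2) that] .
    ultimately show ?thesis
      using C_1_Lipschitz[of "partial_deriv i f" R] by metis
  qed
  then obtain L where L: "\<And>i. L i \<ge> 0"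
    "\<And>i x y. \<bar>partial_deriv i f x - partial_deriv i f y\<bar> \<le> L i * norm (x - y)"
    by metis
  have "norm (grad f x - grad f y) \<le> (\<Sum>i\<in>UNIV. L i) * norm (x - y)" for x y
  proof -
    have "norm (grad f x - grad f y) \<le> (\<Sum>i\<in>UNIV. \<bar>(grad f x - grad f y) $ i\<bar>)"
      by (rule norm_le_l1_cart)
    also have "\<dots> \<le> (\<Sum>i\<in>UNIV. L i * norm (x - y))"
      by (intro sum_mono) (simp add: grad_def L(2))
    finally show ?thesis by (simp add: sum_distrib_right)
  qed
  then show ?thesis
    using that[of "sum L UNIV"] L(1) by (simp add: sum_nonneg)
qed

text \<open>On the ball around \<open>y\<close> through \<open>x\<close> the gradient differs from
  \<open>grad f y\<close> by at most \<open>L * norm (x - y)\<close>, so the mean value inequality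
  applies to \<open>f\<close> minus its linear part. The factor 1/2 of the sharp bound is given up,
  since only the quadratic order matters.\<close>

lemma Taylor_bound_grad:
  fixes f :: "real ^ 'd \<Rightarrow> real"
  assumes "f differentiable_on UNIV" "L \<ge> 0"
    and "\<And>x y. norm (grad f x - grad f y) \<le> L * norm (x - y)"
  shows "\<bar>f x - f y - grad f y \<bullet> (x - y)\<bar> \<le> L * (norm (x - y))\<^sup>2"
proof -
  let ?S = "cball y (norm (x - y))"
  have "norm (f x - f y - grad f y \<bullet> (x - y)) \<le> norm (x - y) * (L * norm (x - y))"
  proof (rule differentiable_bound_linearization[of y x ?S f "\<lambda>z h. grad f z \<bullet> h" y "L * norm (x - y)"])
    show "y + t *\<^sub>R (x - y) \<in> ?S" if "t \<in> {0..1}" for t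
      using that mult_left_le_one_le[of "norm (x - y)" t] by (simp add: dist_norm)
    show "(f has_derivative (\<lambda>h. grad f z \<bullet> h)) (at z within ?S)" for z
      using assms(1) by (simp add: has_derivative_at_withinI has_derivative_grad differentiable_on_def)
    show "onorm ((\<lambda>h. grad f z \<bullet> h) - (\<lambda>h. grad f y \<bullet> h)) \<le> L * norm (x - y)" if "z \<in> ?S" for z
    proof (rule onorm_bound)
      fix h
      have "norm (z - y) \<le> norm (x - y)"
        using that by (simp add: dist_norm norm_minus_commute)
      then have g: "norm (grad f z - grad f y) \<le> L * norm (x - y)"
        using assms(2) by (intro order_trans[OF assms(3)] mult_left_mono)
      have "norm (grad f z \<bullet> h - grad f y \<bullet> h) \<le> norm (grad f z - grad f y) * norm h"
        unfolding inner_diff_left[symmetric] real_norm_def by (rule Cauchy_Schwarz_ineq2)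
      also have "\<dots> \<le> L * norm (x - y) * norm h"
        using g by (intro mult_right_mono) simp_all
      finally show "norm (((\<lambda>h. grad f z \<bullet> h) - (\<lambda>h. grad f y \<bullet> h)) h) \<le> L * norm (x - y) * norm h"
        by simp
    qed (use assms(2) in simp)
  qed simp
  then show ?thesis by (simp add: power2_eq_square mult_ac)
qed

lemma test_function_bounds:
  fixes v :: "real ^ 'd \<Rightarrow> real"
  assumes "test_function v"
  obtains R L where "L \<ge> 0" "\<And>x. norm x > R \<Longrightarrow> v x = 0" "\<And>x. norm x > R \<Longrightarrow> grad v x = 0"
    "\<And>x. \<bar>v x\<bar> \<le> L" "\<And>x. norm (grad v x) \<le> L" "\<And>x y. \<bar>v x - v y\<bar> \<le> L * norm (x - y)"
    "\<And>x y. \<bar>v x - v y - grad v y \<bullet> (x - y)\<bar> \<le> L * (norm (x - y))\<^sup>2"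
proof -
  have C: "C_k k v" for k
    using assms by (simp add: test_function_def)
  have "bounded (closure {x. v x \<noteq> 0})"
    using assms by (simp add: test_function_def compact_imp_bounded)
  then obtain R where R: "R > 0" "closure {x. v x \<noteq> 0} \<subseteq> cball 0 R"
    by (meson bounded_pos mem_cball_0 subsetI)
  have v0: "v x = 0" if "norm x > R" for x
    using R that closure_subset[of "{x. v x \<noteq> 0}"] by (auto simp: subset_iff)
  have g0: "grad v x = 0" if "norm x > R" for x
    using partial_deriv_eq_0_outside[OF v0 that] by (simp add: grad_def vec_eq_iff)
  obtain K where K: "K \<ge> 0" "\<And>x. norm (v x) \<le> K"
    using bounded_if_eq_0_outside[of v R] C[of 0] v0 by (metis C_k.simps(1))
  obtain L1 where L1: "L1 \<ge> 0" "\<And>x. norm (grad v x) \<le> L1" "\<And>x y. \<bar>v x - v y\<bar> \<le> L1 * norm (x - y)"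
    using C_1_Lipschitz[of v R] C[of 1] v0 by metis
  obtain L2 where L2: "L2 \<ge> 0" "\<And>x y. norm (grad v x - grad v y) \<le> L2 * norm (x - y)"
    using C_2_grad_Lipschitz[of v R] C[of 2] v0 by metis
  have T: "\<bar>v x - v y - grad v y \<bullet> (x - y)\<bar> \<le> L2 * (norm (x - y))\<^sup>2" for x y
    using C[of 1] L2 by (intro Taylor_bound_grad) auto
  \<comment> \<open>A single constant serves all four estimates, so that the error term has one
    parameter.\<close>
  define L where "L = K + L1 + L2"
  have L: "K \<le> L" "L1 \<le> L" "L2 \<le> L" "0 \<le> L"
    using K L1 L2 by (auto simp: L_def)
  show ?thesis
  proof (rule that[of L R])
    show "\<bar>v x\<bar> \<le> L" "norm (grad v x) \<le> L" for x
      using K(2)[of x] L1(2)[of x] L by auto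
    show "\<bar>v x - v y\<bar> \<le> L * norm (x - y)" for x y
      using L1(3)[of x y] L by (meson mult_right_mono norm_ge_zero order_trans)
    show "\<bar>v x - v y - grad v y \<bullet> (x - y)\<bar> \<le> L * (norm (x - y))\<^sup>2" for x y
      using T[of x y] L by (meson mult_right_mono zero_le_power2 order_trans)
  qed (use R L v0 g0 in auto)
qed

subsection \<open>The nonlocal energy\<close>

lemma hat_tensor_mult_vec: "hat_tensor x *v w = (sgn x \<bullet> w) *\<^sub>R sgn x"
  by (simp add: hat_tensor_def matrix_vector_mult_def vec_eq_iff inner_vec_def
      sum_distrib_right sum_distrib_left mult_ac)

lemma A_frac_quadratic_form:
  fixes x w :: "real ^ 'd"
  shows "(A_frac s \<epsilon> x *v w) \<bullet> w =
    (1 - (1 + 2 * s) / 2 * \<epsilon>) * (norm w)\<^sup>2 + (real CARD('d) + 2 * s) / 2 * \<epsilon> * (sgn x \<bullet> w)\<^sup>2"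
  by (simp add: A_frac_def matrix_vector_mult_add_rdistrib scaleR_matrix_vector_assoc[symmetric]
      hat_tensor_mult_vec inner_add_left power2_norm_eq_inner) (simp add: power2_eq_square)

lemma A_loc_quadratic_form:
  fixes x w :: "real ^ 'd"
  shows "(A_loc \<epsilon> x *v w) \<bullet> w = (1 - \<epsilon>) * (norm w)\<^sup>2 + \<epsilon> * (sgn x \<bullet> w)\<^sup>2"
  by (simp add: A_loc_def matrix_vector_mult_add_rdistrib scaleR_matrix_vector_assoc[symmetric]
      hat_tensor_mult_vec inner_add_left power2_norm_eq_inner) (simp add: power2_eq_square)

text \<open>The average of \<open>A_frac s \<epsilon> x\<close> and \<open>A_frac s \<epsilon> y\<close> may be replaced by \<open>A_frac s \<epsilon> y\<close>
  alone, because the remaining factors are symmetric in \<open>x\<close> and \<open>y\<close>.\<close>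

lemma J_frac_eq_nn_integral_increments:
  fixes v :: "real ^ 'd \<Rightarrow> real"
  assumes [measurable]: "v \<in> borel_measurable borel"
  defines "a \<equiv> \<lambda>s \<epsilon>. 1 - (1 + 2 * s) / 2 * \<epsilon>" and "b \<equiv> \<lambda>s \<epsilon>. (real CARD('d) + 2 * s) / 2 * \<epsilon>"
  assumes nonneg: "0 \<le> a s \<epsilon>" "0 \<le> b s \<epsilon>"
  shows "J_frac s \<epsilon> v = ennreal (kappa CARD('d) s / 2) *
    (\<integral>\<^sup>+y. \<integral>\<^sup>+h. ennreal (norm h powr (- real CARD('d) - 2 * s) *
        (a s \<epsilon> + b s \<epsilon> * (sgn y \<bullet> sgn h)\<^sup>2) * (v (y + h) - v y)\<^sup>2) \<partial>lborel \<partial>lborel)"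
proof -
  define g where "g x y = norm (x - y) powr (- real CARD('d) - 2 * s) *
    (a s \<epsilon> + b s \<epsilon> * (sgn y \<bullet> sgn (x - y))\<^sup>2) * (v x - v y)\<^sup>2" for x y
  have [measurable]: "(\<lambda>p. g (fst p) (snd p)) \<in> borel_measurable (borel \<Otimes>\<^sub>M borel)"
    "(\<lambda>p. g (snd p) (fst p)) \<in> borel_measurable (borel \<Otimes>\<^sub>M borel)"
    "\<And>y. (\<lambda>x. g x y) \<in> borel_measurable borel" "\<And>y. (\<lambda>x. g y x) \<in> borel_measurable borel"
    unfolding g_def by measurable
  have g_nonneg: "0 \<le> g x y" for x y
    using nonneg by (simp add: g_def)
  \<comment> \<open>Off the diagonal \<open>sgn (x - y)\<close> is a unit vector whose sign does not
    affect the squares, so averaging the matrices averages \<open>g x y\<close> and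
    \<open>g y x\<close>. On the diagonal the increment vanishes.\<close>
  have k_eq: "k_frac s \<epsilon> x y * \<bar>v x - v y\<bar>\<^sup>2 = g x y / 2 + g y x / 2" for x y
  proof (cases "x = y")
    case True
    then show ?thesis by (simp add: g_def)
  next
    case False
    have "sgn (y - x) = - sgn (x - y)"
      using sgn_minus[of "x - y"] by simp
    then have "g y x = norm (x - y) powr (- real CARD('d) - 2 * s) *
        (a s \<epsilon> + b s \<epsilon> * (sgn x \<bullet> sgn (x - y))\<^sup>2) * (v x - v y)\<^sup>2"
      by (simp add: g_def norm_minus_commute power2_commute)
    moreover have "(((1 / 2) *\<^sub>R (A_frac s \<epsilon> x + A_frac s \<epsilon> y)) *v sgn (x - y)) \<bullet> sgn (x - y) =
        ((a s \<epsilon> + b s \<epsilon> * (sgn x \<bullet> sgn (x - y))\<^sup>2) + (a s \<epsilon> + b s \<epsilon> * (sgn y \<bullet> sgn (x - y))\<^sup>2)) / 2"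
      using False
      by (simp add: scaleR_matrix_vector_assoc[symmetric] matrix_vector_mult_add_rdistrib
          inner_add_left A_frac_quadratic_form a_def b_def norm_sgn)
    ultimately show ?thesis
      by (simp add: k_frac_def g_def algebra_simps add_divide_distrib)
  qed
  have "(\<integral>\<^sup>+y. \<integral>\<^sup>+x. ennreal (k_frac s \<epsilon> x y * \<bar>v x - v y\<bar>\<^sup>2) \<partial>lborel \<partial>lborel) =
      (\<integral>\<^sup>+y. \<integral>\<^sup>+x. ennreal (g x y / 2) \<partial>lborel \<partial>lborel) + (\<integral>\<^sup>+y. \<integral>\<^sup>+x. ennreal (g y x / 2) \<partial>lborel \<partial>lborel)"
    unfolding k_eq using g_nonneg by (simp add: nn_integral_add)
  also have "(\<integral>\<^sup>+y. \<integral>\<^sup>+x. ennreal (g y x / 2) \<partial>lborel \<partial>lborel) =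
      (\<integral>\<^sup>+y. \<integral>\<^sup>+x. ennreal (g x y / 2) \<partial>lborel \<partial>lborel)"
    by (rule nn_integral_lborel_swap) (unfold split_beta borel_prod[symmetric], measurable)
  also have "(\<integral>\<^sup>+y. \<integral>\<^sup>+x. ennreal (g x y / 2) \<partial>lborel \<partial>lborel) + \<dots> =
      (\<integral>\<^sup>+y. \<integral>\<^sup>+x. ennreal (g x y) \<partial>lborel \<partial>lborel)"
    using g_nonneg by (simp flip: nn_integral_add ennreal_plus)
  also have "\<dots> = (\<integral>\<^sup>+y. \<integral>\<^sup>+h. ennreal (g (y + h) y) \<partial>lborel \<partial>lborel)"
    by (simp add: nn_integral_lborel_translate[where f = "\<lambda>x. ennreal (g x _)"])
  finally show ?thesis
    by (simp add: J_frac_def g_def)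
qed

text \<open>The pole of \<open>Gamma\<close> at -1 produces the decay. Applying the functional
  equation twice gives \<open>Gamma (2 - s) = - (1 - s) * s * Gamma (- s)\<close>, so
  \<open>kappa d s / (1 - s)\<close> agrees with an expression continuous at \<open>s = 1\<close>,
  whose value there is \<open>2 * Gamma (d / 2 + 1) / pi powr (d / 2)\<close>.\<close>

lemma kappa_asymptotics: "((\<lambda>s. kappa d s / (1 - s)) \<longlongrightarrow> 2 / unit_ball_vol (real d)) (at_left 1)"
proof -
  have "\<forall>\<^sub>F s in at_left 1. s \<in> {1/2<..<1::real}"
    by (rule eventually_at_left_real) simp
  then have "\<forall>\<^sub>F s in at_left 1. 2 powr (2 * s - 1) * Gamma (real d / 2 + s) * s / (pi powr (real d / 2) * Gamma (2 - s)) =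
      kappa d s / (1 - s)"
  proof eventually_elim
    case (elim s)
    have "Gamma (2 - s) = (1 - s) * Gamma (1 - s)"
    proof -
      have "1 - s \<notin> \<int>\<^sub>\<le>\<^sub>0"
        using elim by (auto elim!: nonpos_Ints_cases)
      then show ?thesis
        using Gamma_plus1[of "1 - s"] by simp
    qed
    moreover have "- s \<notin> \<int>\<^sub>\<le>\<^sub>0"
    proof
      assume "- s \<in> \<int>\<^sub>\<le>\<^sub>0"
      then obtain m :: int where "- s = of_int m" by (auto elim!: nonpos_Ints_cases)
      then have "m < 0" "m > - 1" using elim by auto
      then show False by simp
    qed
    then have "Gamma (1 - s) = - s * Gamma (- s)"
      using Gamma_plus1[of "- s"] by simp
    ultimately have "\<bar>Gamma (2 - s)\<bar> = (1 - s) * s * \<bar>Gamma (- s)\<bar>"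
      using elim by (simp add: abs_mult)
    moreover have pos: "Gamma (2 - s) > 0"
      using elim by (intro Gamma_real_pos) simp
    ultimately have "\<bar>Gamma (- s)\<bar> = Gamma (2 - s) / ((1 - s) * s)"
      using elim by (simp add: field_simps)
    then show ?case
      using elim pos by (simp add: kappa_def)
  qed
  moreover have "((\<lambda>s. 2 powr (2 * s - 1) * Gamma (real d / 2 + s) * s / (pi powr (real d / 2) * Gamma (2 - s)))
      \<longlongrightarrow> 2 powr (2 * 1 - 1) * Gamma (real d / 2 + 1) * 1 / (pi powr (real d / 2) * Gamma (2 - 1))) (at_left 1)"
  proof (intro tendsto_intros)
    have "real d / 2 + 1 > 0" by (simp add: add_nonneg_pos)
    then show "real d / 2 + 1 \<notin> \<int>\<^sub>\<le>\<^sub>0" by (auto elim!: nonpos_Ints_cases)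
  qed auto
  ultimately show ?thesis
    by (simp add: unit_ball_vol_def filterlim_cong[OF refl refl] tendsto_cong)
qed

text \<open>Uniformly in \<open>s \<in> [1/2, 1]\<close>, this dominates the error made by replacing \<open>v (y + h) - v y\<close>
  by its linearization for \<open>norm h \<le> 1\<close> and by \<open>0\<close> otherwise.\<close>

definition remainder :: "real \<Rightarrow> real \<Rightarrow> 'a::euclidean_space \<Rightarrow> 'a \<Rightarrow> real" where
  "remainder R L y h =
     2 * L\<^sup>2 * norm h powr - (real DIM('a) - 1) * indicator (cball 0 1) h * indicator (cball 0 (R + 1)) y
   + 4 * L\<^sup>2 * norm h powr - (real DIM('a) + 1) * indicator (- cball 0 1) h
     * (indicator (cball 0 R) y + indicator (cball 0 R) (y + h))"

lemma remainder_nonneg: "0 \<le> remainder R L y h"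
  by (simp add: remainder_def)

lemma nn_integral_remainder_finite:
  assumes "2 \<le> DIM('a)" "0 \<le> L"
  shows "(\<integral>\<^sup>+y. \<integral>\<^sup>+h. ennreal (remainder R L (y :: 'a::euclidean_space) h) \<partial>lborel \<partial>lborel) < \<infinity>"
proof -
  define near far where "near = (\<integral>\<^sup>+(h::'a). ennreal (norm h powr - (real DIM('a) - 1)) * indicator (cball 0 1) h \<partial>lborel)"
    and "far = (\<integral>\<^sup>+(h::'a). ennreal (norm h powr - (real DIM('a) + 1)) * indicator (- cball 0 1) h \<partial>lborel)"
  \<comment> \<open>The homogeneity formula is applied to a constant function with exponent
    \<open>d - 1\<close>, which is positive because the dimension is at least 2.\<close>
  have "near = ennreal (DIM('a) / (DIM('a) - (real DIM('a) - 1))) * (\<integral>\<^sup>+(h::'a). 1 * indicator (cball 0 1) h \<partial>lborel)"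
    unfolding near_def
    by (subst nn_integral_homogeneous_powr_cball[symmetric]) (use assms in auto)
  then have near: "near < \<infinity>"
    by (simp add: emeasure_cball ennreal_mult_less_top)
  have far: "far < \<infinity>"
    unfolding far_def by (rule nn_integral_powr_outside_cball_finite)
  let ?K = "ennreal (2 * L\<^sup>2)" and ?K' = "ennreal (4 * L\<^sup>2)"
  let ?n = "\<lambda>h::'a. ennreal (norm h powr - (real DIM('a) - 1)) * indicator (cball 0 1) h"
  let ?f = "\<lambda>h::'a. ennreal (norm h powr - (real DIM('a) + 1)) * indicator (- cball 0 1) h"
  have "ennreal (remainder R L y h) =
      indicator (cball 0 (R + 1)) y * (?K * ?n h) + (indicator (cball 0 R) y * (?K' * ?f h) +
      ?K' * ?f h * indicator (cball 0 R) (y + h))" for y h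
    by (auto simp: remainder_def indicator_def simp flip: ennreal_mult ennreal_plus)
  then have "(\<integral>\<^sup>+y. \<integral>\<^sup>+h. ennreal (remainder R L (y :: 'a) h) \<partial>lborel \<partial>lborel) =
      (\<integral>\<^sup>+y. indicator (cball 0 (R + 1)) y * (?K * near) + (indicator (cball 0 R) y * (?K' * far) +
      (\<integral>\<^sup>+h. ?K' * ?f h * indicator (cball 0 R) (y + h) \<partial>lborel)) \<partial>lborel)"
    by (simp add: nn_integral_add nn_integral_cmult near_def far_def)
  also have "\<dots> = emeasure lborel (cball 0 (R + 1) :: 'a set) * (?K * near) +
      (emeasure lborel (cball 0 R :: 'a set) * (?K' * far) +
      (\<integral>\<^sup>+y. \<integral>\<^sup>+h. ?K' * ?f h * indicator (cball 0 R) (y + h) \<partial>lborel \<partial>lborel))"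
    by (simp add: nn_integral_add nn_integral_multc)
  \<comment> \<open>Only \<open>y + h\<close> is confined here, so \<open>y\<close> is integrated
    first: a shifted ball has a volume independent of \<open>h\<close>.\<close>
  also have "(\<integral>\<^sup>+y. \<integral>\<^sup>+h. ?K' * ?f h * indicator (cball 0 R) (y + h) \<partial>lborel \<partial>lborel) =
      (\<integral>\<^sup>+h. \<integral>\<^sup>+y. ?K' * ?f h * indicator (cball 0 R) (y + h) \<partial>lborel \<partial>lborel)"
    by (rule nn_integral_lborel_swap) (unfold split_beta borel_prod[symmetric], measurable)
  also have "\<dots> = (\<integral>\<^sup>+h. ?K' * ?f h * emeasure lborel (cball 0 R :: 'a set) \<partial>lborel)"
  proof (rule nn_integral_cong)
    fix h :: 'a
    have "(\<integral>\<^sup>+y. indicator (cball 0 R) (y + h) \<partial>lborel) = emeasure lborel (cball 0 R :: 'a set)"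
      using nn_integral_lborel_translate[of "indicator (cball 0 R)" h] by (simp add: add.commute)
    then show "(\<integral>\<^sup>+y. ?K' * ?f h * indicator (cball 0 R) (y + h) \<partial>lborel) = ?K' * ?f h * emeasure lborel (cball 0 R :: 'a set)"
      by (simp add: nn_integral_cmult)
  qed
  also have "\<dots> = ?K' * far * emeasure lborel (cball 0 R :: 'a set)"
    by (simp add: nn_integral_cmult nn_integral_multc far_def)
  finally show ?thesis
    using near far emeasure_lborel_cball_finite[of "0::'a"] by (simp add: ennreal_mult_less_top)
qed

text \<open>For \<open>norm h \<le> 1\<close> the difference of squares factors into a Taylor error
  of order 2 and a sum of order 1, which leaves \<open>norm h\<close> to the power
  \<open>3 - d - 2 * s\<close>; this is largest at \<open>s = 1\<close>, with exponent
  \<open>1 - d\<close>. For \<open>norm h > 1\<close> the kernel is largest at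
  \<open>s = 1/2\<close>, with exponent \<open>- d - 1\<close>. These are the two exponents in
  \<open>remainder\<close>.\<close>

lemma increments_vs_linearization:
  fixes v :: "'a::euclidean_space \<Rightarrow> real"
  assumes s: "1 / 2 \<le> s" "s \<le> 1" and W: "0 \<le> W" "W \<le> K" and L: "0 \<le> L"
    and v0: "\<And>x. norm x > R \<Longrightarrow> v x = 0" and g0: "\<And>x. norm x > R \<Longrightarrow> g x = 0"
    and vL: "\<And>x. \<bar>v x\<bar> \<le> L" and gL: "\<And>x. norm (g x) \<le> L"
    and Lip: "\<And>x y. \<bar>v x - v y\<bar> \<le> L * norm (x - y)"
    and Taylor: "\<And>x y. \<bar>v x - v y - g y \<bullet> (x - y)\<bar> \<le> L * (norm (x - y))\<^sup>2"
  shows "\<bar>norm h powr (- real DIM('a) - 2 * s) * W * (v (y + h) - v y)\<^sup>2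
      - norm h powr (- real DIM('a) - 2 * s) * W * (g y \<bullet> h)\<^sup>2 * indicator (cball 0 1) h\<bar>
    \<le> K * remainder R L y h" (is "\<bar>?P * W * ?D\<^sup>2 - ?P * W * ?l\<^sup>2 * _\<bar> \<le> _")
proof (cases "norm h \<le> 1")
  case True
  have K: "0 \<le> K" using W by simp
  have "\<bar>?D\<^sup>2 - ?l\<^sup>2\<bar> \<le> 2 * L\<^sup>2 * norm h ^ 3 * indicator (cball 0 (R + 1)) y"
  proof (cases "norm y \<le> R + 1")
    case False
    \<comment> \<open>If \<open>y\<close> is more than \<open>R + 1\<close> from the origin, then
      \<open>y + h\<close> is still outside the ball of radius \<open>R\<close> and every term
      vanishes; hence the enlarged radius in \<open>remainder\<close>.\<close>
    have "norm y \<le> norm (y + h) + norm h"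
      using norm_triangle_ineq4[of "y + h" h] by simp
    then show ?thesis
      using False True v0[of y] v0[of "y + h"] g0[of y] by simp
  next
    case yR: True
    have "\<bar>?D - ?l\<bar> \<le> L * (norm h)\<^sup>2"
      using Taylor[of "y + h" y] by simp
    moreover have "\<bar>?D + ?l\<bar> \<le> 2 * L * norm h"
    proof -
      have "\<bar>?l\<bar> \<le> L * norm h"
        using Cauchy_Schwarz_ineq2[of "g y" h] mult_right_mono[OF gL[of y] norm_ge_zero[of h]] by simp
      then show ?thesis
        using Lip[of "y + h" y] by simp
    qed
    ultimately have "\<bar>?D - ?l\<bar> * \<bar>?D + ?l\<bar> \<le> L * (norm h)\<^sup>2 * (2 * L * norm h)"
      using L by (intro mult_mono) auto
    moreover have "\<bar>?D\<^sup>2 - ?l\<^sup>2\<bar> = \<bar>?D - ?l\<bar> * \<bar>?D + ?l\<bar>"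
      by (simp add: abs_mult[symmetric] power2_eq_square algebra_simps)
    ultimately show ?thesis
      using yR by (simp add: power2_eq_square power3_eq_cube mult_ac)
  qed
  moreover have "?P * norm h ^ 3 \<le> norm h powr - (real DIM('a) - 1)"
  proof (cases "h = 0")
    case False
    then have "?P * norm h ^ 3 = norm h powr (- real DIM('a) - 2 * s + 3)"
      by (simp add: powr_add powr_realpow)
    also have "\<dots> \<le> norm h powr - (real DIM('a) - 1)"
      using s True False by (intro powr_mono') auto
    finally show ?thesis .
  qed simp
  ultimately have "?P * \<bar>?D\<^sup>2 - ?l\<^sup>2\<bar> \<le> norm h powr - (real DIM('a) - 1) * (2 * L\<^sup>2 * indicator (cball 0 (R + 1)) y)"
  proof -
    assume 1: "\<bar>?D\<^sup>2 - ?l\<^sup>2\<bar> \<le> 2 * L\<^sup>2 * norm h ^ 3 * indicator (cball 0 (R + 1)) y"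
      and 2: "?P * norm h ^ 3 \<le> norm h powr - (real DIM('a) - 1)"
    have "?P * \<bar>?D\<^sup>2 - ?l\<^sup>2\<bar> \<le> (?P * norm h ^ 3) * (2 * L\<^sup>2 * indicator (cball 0 (R + 1)) y)"
      using mult_left_mono[OF 1, of ?P] by (simp add: mult_ac)
    also have "\<dots> \<le> norm h powr - (real DIM('a) - 1) * (2 * L\<^sup>2 * indicator (cball 0 (R + 1)) y)"
      using 2 by (intro mult_right_mono) auto
    finally show ?thesis .
  qed
  then have "W * (?P * \<bar>?D\<^sup>2 - ?l\<^sup>2\<bar>) \<le> K * remainder R L y h"
    using True W K by (intro mult_mono) (auto simp: remainder_def mult_ac)
  moreover have "\<bar>?P * W * ?D\<^sup>2 - ?P * W * ?l\<^sup>2 * indicator (cball 0 1) h\<bar> = W * (?P * \<bar>?D\<^sup>2 - ?l\<^sup>2\<bar>)"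
  proof -
    have "?P * W * ?D\<^sup>2 - ?P * W * ?l\<^sup>2 * indicator (cball 0 1) h = W * (?P * (?D\<^sup>2 - ?l\<^sup>2))"
      using True by (simp add: algebra_simps)
    then show ?thesis using W by (simp add: abs_mult)
  qed
  ultimately show ?thesis by simp
next
  case False
  have K: "0 \<le> K" using W by simp
  have *: "(v x)\<^sup>2 \<le> L\<^sup>2 * indicator (cball 0 R) x" for x
    using vL[of x] v0[of x] L by (auto simp: indicator_def abs_le_square_iff[symmetric])
  have "?D\<^sup>2 \<le> 2 * (v (y + h))\<^sup>2 + 2 * (v y)\<^sup>2"
    using zero_le_power2[of "v (y + h) + v y"] by (simp add: power2_eq_square algebra_simps)
  also have "\<dots> \<le> 4 * L\<^sup>2 * (indicator (cball 0 R) y + indicator (cball 0 R) (y + h))"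
  proof -
    have "0 \<le> L\<^sup>2 * indicator (cball 0 R) y" "0 \<le> L\<^sup>2 * indicator (cball 0 R) (y + h)"
      by simp_all
    then show ?thesis
      using *[of y] *[of "y + h"] unfolding distrib_left mult.assoc by linarith
  qed
  finally have D: "?D\<^sup>2 \<le> 4 * L\<^sup>2 * (indicator (cball 0 R) y + indicator (cball 0 R) (y + h))" .
  have "?P \<le> norm h powr - (real DIM('a) + 1)"
    using False s by (intro powr_mono) auto
  then have "?P * ?D\<^sup>2 \<le> norm h powr - (real DIM('a) + 1) *
      (4 * L\<^sup>2 * (indicator (cball 0 R) y + indicator (cball 0 R) (y + h)))"
    using D by (intro mult_mono) auto
  then have "W * (?P * ?D\<^sup>2) \<le> K * remainder R L y h"
    using False W K by (intro mult_mono) (auto simp: remainder_def mult_ac)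
  then show ?thesis
    using False W by (simp add: abs_mult mult_ac)
qed

text \<open>Writing \<open>p \<bullet> h\<close> as \<open>norm h\<close> times
  \<open>p \<bullet> sgn h\<close> leaves a 0-homogeneous function times \<open>norm h\<close> to
  the power \<open>- (d + 2 * s - 2)\<close>. The gap between \<open>d\<close> and
  \<open>d + 2 * s - 2\<close> is \<open>2 - 2 * s\<close>, the source of the blow-up.\<close>

lemma nn_integral_linearized_cball:
  fixes p q :: "real ^ 'd"
  assumes d: "2 \<le> CARD('d)" and s: "0 < s" "s < 1" and ab: "0 \<le> a" "0 \<le> b"
  shows "(\<integral>\<^sup>+h. ennreal (norm h powr (- real CARD('d) - 2 * s) * (a + b * (q \<bullet> sgn h)\<^sup>2) * (p \<bullet> h)\<^sup>2
      * indicator (cball 0 1) h) \<partial>lborel) =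
    ennreal (unit_ball_vol (real CARD('d)) / ((2 - 2 * s) * (real CARD('d) + 2))
      * (a * (real CARD('d) + 2) * (norm p)\<^sup>2 + b * ((norm p)\<^sup>2 * (norm q)\<^sup>2 + 2 * (q \<bullet> p)\<^sup>2)))"
    (is "?L = ennreal (?V / _ * ?M)")
proof -
  define n where "n = real CARD('d)"
  define F :: "real ^ 'd \<Rightarrow> real" where "F h = (a + b * (q \<bullet> sgn h)\<^sup>2) * (p \<bullet> sgn h)\<^sup>2" for h
  have [measurable]: "F \<in> borel_measurable borel"
    unfolding F_def by measurable
  have F_nonneg: "0 \<le> F h" for h
    using ab by (simp add: F_def)
  have n: "2 \<le> n" using d by (simp add: n_def)
  have I: "integrable lborel (\<lambda>h. a * (indicator (cball 0 1) h * (p \<bullet> sgn h)\<^sup>2) +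
      b * (indicator (cball 0 1) h * ((q \<bullet> sgn h)\<^sup>2 * (p \<bullet> sgn h)\<^sup>2)))"
    by simp
  have "?L = (\<integral>\<^sup>+h. ennreal (F h) * ennreal (norm h powr - (n + 2 * s - 2)) * indicator (cball 0 1) h \<partial>lborel)"
  proof (rule nn_integral_cong)
    fix h :: "real ^ 'd"
    have "norm h powr (- n - 2 * s) * (p \<bullet> h)\<^sup>2 = norm h powr - (n + 2 * s - 2) * (p \<bullet> sgn h)\<^sup>2"
    proof (cases "h = 0")
      case False
      have "norm h powr - (n + 2 * s - 2) = norm h powr ((- n - 2 * s) + 2)"
        by (simp add: algebra_simps)
      also have "\<dots> = norm h powr (- n - 2 * s) * (norm h)\<^sup>2"
        using False by (simp add: powr_add)
      finally show ?thesis
        using False by (simp add: sgn_div_norm power_mult_distrib power_inverse divide_simps)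
    qed simp
    then have "norm h powr (- n - 2 * s) * (a + b * (q \<bullet> sgn h)\<^sup>2) * (p \<bullet> h)\<^sup>2 =
        F h * norm h powr - (n + 2 * s - 2)"
      by (simp add: F_def mult_ac)
    then show "ennreal (norm h powr (- real CARD('d) - 2 * s) * (a + b * (q \<bullet> sgn h)\<^sup>2) * (p \<bullet> h)\<^sup>2
        * indicator (cball 0 1) h) =
      ennreal (F h) * ennreal (norm h powr - (n + 2 * s - 2)) * indicator (cball 0 1) h"
      using F_nonneg[of h] by (auto simp: n_def indicator_def simp flip: ennreal_mult)
  qed
  also have "\<dots> = ennreal (n / (2 - 2 * s)) * (\<integral>\<^sup>+h. ennreal (F h) * indicator (cball 0 1) h \<partial>lborel)"
  proof -
    have "F (t *\<^sub>R h) = F h" if "t > 0" for t h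
      using that by (simp add: F_def sgn_scaleR)
    moreover have "real DIM(real ^ 'd) - (n + 2 * s - 2) = 2 - 2 * s"
      by (simp add: n_def)
    ultimately show ?thesis
      using n s nn_integral_homogeneous_powr_cball[of "\<lambda>h. ennreal (F h)" "n + 2 * s - 2"]
      by (simp add: n_def)
  qed
  also have "(\<integral>\<^sup>+h. ennreal (F h) * indicator (cball 0 1) h \<partial>lborel) =
      (\<integral>\<^sup>+h. ennreal (a * (indicator (cball 0 1) h * (p \<bullet> sgn h)\<^sup>2) +
      b * (indicator (cball 0 1) h * ((q \<bullet> sgn h)\<^sup>2 * (p \<bullet> sgn h)\<^sup>2))) \<partial>lborel)"
    by (intro nn_integral_cong) (auto simp: F_def indicator_def algebra_simps)
  also have "\<dots> = ennreal (\<integral>h. a * (indicator (cball 0 1) h * (p \<bullet> sgn h)\<^sup>2) +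
      b * (indicator (cball 0 1) h * ((q \<bullet> sgn h)\<^sup>2 * (p \<bullet> sgn h)\<^sup>2)) \<partial>lborel)"
    using I ab by (intro nn_integral_eq_integral) simp_all
  also have "(\<integral>h. a * (indicator (cball 0 1) h * (p \<bullet> sgn h)\<^sup>2) +
      b * (indicator (cball 0 1) h * ((q \<bullet> sgn h)\<^sup>2 * (p \<bullet> sgn h)\<^sup>2)) \<partial>lborel) =
      a * (\<integral>h. indicator (cball 0 1) h * (p \<bullet> sgn h)\<^sup>2 \<partial>lborel) +
      b * (\<integral>h. indicator (cball 0 1) h * ((q \<bullet> sgn h)\<^sup>2 * (p \<bullet> sgn h)\<^sup>2) \<partial>lborel)"
    by simp
  also have "\<dots> = a * (?V / (n * (n + 2)) * (n + 2) * (norm p)\<^sup>2) +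
      b * (?V / (n * (n + 2)) * ((norm q)\<^sup>2 * (norm p)\<^sup>2 + 2 * (q \<bullet> p)\<^sup>2))"
    by (simp only: mixed_moment_cball n_def)
  also have "\<dots> = ?V / (n * (n + 2)) * ?M"
    by (simp add: n_def algebra_simps add_divide_distrib)
  also have "ennreal (n / (2 - 2 * s)) * ennreal (?V / (n * (n + 2)) * ?M) =
      ennreal (n / (2 - 2 * s) * (?V / (n * (n + 2)) * ?M))"
    using n s ab by (subst ennreal_mult) (auto intro!: mult_nonneg_nonneg divide_nonneg_nonneg add_nonneg_nonneg)
  also have "n / (2 - 2 * s) * (?V / (n * (n + 2)) * ?M) = ?V / ((2 - 2 * s) * (n + 2)) * ?M"
    using n by simp
  finally show ?thesis
    by (simp only: n_def)
qed

section \<open>Passage to the limit\<close>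

theorem lemma2p3:
  fixes v :: "real ^ 'd \<Rightarrow> real" and \<epsilon> :: real
  assumes "CARD('d) \<ge> 2"
    and "0 \<le> \<epsilon>" and "\<epsilon> \<le> 1 / 2"
    and "test_function v"
  shows "((\<lambda>s. J_frac s \<epsilon> v) \<longlongrightarrow>
           ennreal (1 / 2 * (\<integral> x. (A_loc \<epsilon> x *v grad v x) \<bullet> grad v x \<partial>lborel))) (at_left 1)"
proof -
  define n where "n = real CARD('d)"
  define V where "V = unit_ball_vol n"
  have n: "2 \<le> n" using assms(1) by (simp add: n_def)
  have V: "0 < V" using n by (simp add: V_def)
  obtain R L where L: "L \<ge> 0"
    and v0: "\<And>x. norm x > R \<Longrightarrow> v x = 0" and g0: "\<And>x. norm x > R \<Longrightarrow> grad v x = 0"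
    and vL: "\<And>x. \<bar>v x\<bar> \<le> L" and gL: "\<And>x. norm (grad v x) \<le> L"
    and Lip: "\<And>x y. \<bar>v x - v y\<bar> \<le> L * norm (x - y)"
    and Taylor: "\<And>x y. \<bar>v x - v y - grad v y \<bullet> (x - y)\<bar> \<le> L * (norm (x - y))\<^sup>2"
    using test_function_bounds[OF assms(4)] by metis
  have C: "C_k k v" for k
    using assms(4) by (simp add: test_function_def)
  have [measurable]: "v \<in> borel_measurable borel"
    using C[of 0] by (intro borel_measurable_continuous_onI) simp
  have [measurable]: "grad v \<in> borel_measurable borel"
    unfolding grad_def[abs_def] using C[of 1]
    by (intro borel_measurable_continuous_onI continuous_on_vec_lambda) simp

  define a b where "a s = 1 - (1 + 2 * s) / 2 * \<epsilon>" and "b s = (n + 2 * s) / 2 * \<epsilon>" for s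
  define P Q where "P = (\<integral>y. (norm (grad v y))\<^sup>2 \<partial>lborel)" and "Q = (\<integral>y. (sgn y \<bullet> grad v y)\<^sup>2 \<partial>lborel)"
  \<comment> \<open>A quantity that vanishes with the gradient may be cut off to the ball of radius
    \<open>R\<close>, where boundedness and measurability give integrability.\<close>
  have supp: "f (grad v y) y = indicator (cball 0 R) y * f (grad v y) y" if "f 0 y = 0"
    for f :: "real ^ 'd \<Rightarrow> real ^ 'd \<Rightarrow> real" and y
    using g0[of y] that by (auto simp: indicator_def)
  have gL2: "(norm (grad v y))\<^sup>2 \<le> L\<^sup>2" for y
    using gL[of y] by (simp add: power_mono)
  have intP: "integrable lborel (\<lambda>y. (norm (grad v y))\<^sup>2)"
    by (subst supp[of "\<lambda>p y. (norm p)\<^sup>2"], simp, rule integrable_indicator_cball_bounded[where K = "L\<^sup>2"])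
      (simp_all add: gL2)
  have intQ: "integrable lborel (\<lambda>y. (sgn y \<bullet> grad v y)\<^sup>2)"
    by (subst supp[of "\<lambda>p y. (sgn y \<bullet> p)\<^sup>2"], simp, rule integrable_indicator_cball_bounded[where K = "L\<^sup>2"])
      (simp_all add: inner_commute[of "sgn _"] order_trans[OF inner_sgn_sq_le gL2])
  have rhs: "(\<integral>x. (A_loc \<epsilon> x *v grad v x) \<bullet> grad v x \<partial>lborel) = (1 - \<epsilon>) * P + \<epsilon> * Q"
    using intP intQ by (simp add: A_loc_quadratic_form P_def Q_def)

  \<comment> \<open>The integral is finite by \<open>nn_integral_remainder_finite\<close>, so
    \<open>enn2real\<close> loses nothing. \<open>D\<close> does not depend on
    \<open>s\<close>.\<close>
  define D where "D = enn2real (\<integral>\<^sup>+y. \<integral>\<^sup>+h. ennreal (remainder R L (y :: real ^ 'd) h) \<partial>lborel \<partial>lborel)"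
  have D: "(\<integral>\<^sup>+y. \<integral>\<^sup>+h. ennreal (remainder R L (y :: real ^ 'd) h) \<partial>lborel \<partial>lborel) = ennreal D" "0 \<le> D"
    using nn_integral_remainder_finite[where 'a = "real ^ 'd"] assms(1) L by (simp_all add: D_def less_top)
  define m where "m s = V / ((2 - 2 * s) * (n + 2)) * ((a s * (n + 2) + b s) * P + 2 * b s * Q)" for s
  define k where "k s = kappa CARD('d) s / 2" for s

  have bounds: "ennreal (k s * m s - k s * ((a s + b s) * D)) \<le> J_frac s \<epsilon> v \<and>
      J_frac s \<epsilon> v \<le> ennreal (k s * m s + k s * ((a s + b s) * D))" if s: "s \<in> {1/2<..<1}" for s
  proof -
    \<comment> \<open>The crude bound \<open>1 + 2 * s \<le> 4\<close> together with
      \<open>\<epsilon> \<le> 1 / 2\<close> already yields \<open>0 \<le> a s\<close>.\<close>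
    have "(1 + 2 * s) * \<epsilon> \<le> 4 * (1 / 2)"
      using s assms(2,3) by (intro mult_mono) auto
    then have ab: "0 \<le> a s" "0 \<le> b s"
      using s assms(2) n by (simp_all add: a_def b_def)
    have k: "0 \<le> k s"
      using s by (simp add: k_def kappa_def)
    define W where "W y h = a s + b s * (sgn y \<bullet> sgn h)\<^sup>2" for y h :: "real ^ 'd"
    have W: "0 \<le> W y h" "W y h \<le> a s + b s" for y h
    proof -
      have "(sgn y \<bullet> sgn h)\<^sup>2 \<le> (norm (sgn y))\<^sup>2"
        by (rule inner_sgn_sq_le)
      also have "\<dots> \<le> 1"
        by (simp add: norm_sgn)
      finally show "W y h \<le> a s + b s"
        using ab by (simp add: W_def mult_left_le)
    qed (use ab in \<open>simp add: W_def\<close>)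
    define G N where "G y h = norm h powr (- n - 2 * s) * W y h * (v (y + h) - v y)\<^sup>2"
      and "N y h = norm h powr (- n - 2 * s) * W y h * (grad v y \<bullet> h)\<^sup>2 * indicator (cball 0 1) h" for y h
    have GN_nonneg: "0 \<le> G y h" "0 \<le> N y h" for y h
      using W by (simp_all add: G_def N_def)
    have [measurable]: "(\<lambda>p. G (fst p) (snd p)) \<in> borel_measurable (borel \<Otimes>\<^sub>M borel)"
      "(\<lambda>p. N (fst p) (snd p)) \<in> borel_measurable (borel \<Otimes>\<^sub>M borel)"
      "(\<lambda>p. remainder R L (fst p) (snd p :: real ^ 'd)) \<in> borel_measurable (borel \<Otimes>\<^sub>M borel)"
      unfolding G_def N_def W_def remainder_def by measurable
    have err: "\<bar>G y h - N y h\<bar> \<le> (a s + b s) * remainder R L y h" for y h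
      using increments_vs_linearization[of s "W y h" "a s + b s" L R v "grad v" h y] s W L v0 g0 vL gL Lip Taylor
      by (simp add: G_def N_def n_def)
    let ?I = "\<lambda>f. \<integral>\<^sup>+y. \<integral>\<^sup>+h. ennreal (f y h) \<partial>lborel \<partial>(lborel :: (real ^ 'd) measure)"
    \<comment> \<open>One additive comparison serves both directions; estimating a difference would
      mean subtracting integrals not yet known to be finite.\<close>
    have I_mono: "?I f \<le> ?I g + ennreal ((a s + b s) * D)"
      if "\<And>y h. f y h \<le> g y h + (a s + b s) * remainder R L y h" "\<And>y h. 0 \<le> g y h"
        and [measurable]: "(\<lambda>p. g (fst p) (snd p)) \<in> borel_measurable (borel \<Otimes>\<^sub>M borel)" for f g
    proof -
      have [measurable]: "(\<lambda>h. remainder R L y (h :: real ^ 'd)) \<in> borel_measurable borel" "g y \<in> borel_measurable borel" for y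
        using measurable_compose_Pair1[of y borel "\<lambda>p. remainder R L (fst p) (snd p)" borel borel]
          measurable_compose_Pair1[of y borel "\<lambda>p. g (fst p) (snd p)" borel borel] by simp_all
      have "?I f \<le> (\<integral>\<^sup>+y. \<integral>\<^sup>+h. ennreal (g y h) + ennreal (a s + b s) * ennreal (remainder R L y h) \<partial>lborel \<partial>lborel)"
        using that(1,2) ab
        by (intro nn_integral_mono) (simp add: remainder_nonneg ennreal_leI flip: ennreal_mult ennreal_plus)
      also have "\<dots> = ?I g + ennreal (a s + b s) * ?I (remainder R L)"
        by (simp add: nn_integral_add nn_integral_cmult)
      finally show ?thesis
        using D ab by (simp add: ennreal_mult)
    qed
    have "G y h \<le> N y h + (a s + b s) * remainder R L y h" "N y h \<le> G y h + (a s + b s) * remainder R L y h" for y h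
      using err[of y h] by simp_all
    then have upper: "?I G \<le> ?I N + ennreal ((a s + b s) * D)"
      and lower: "?I N \<le> ?I G + ennreal ((a s + b s) * D)"
      using GN_nonneg by (intro I_mono; simp)+
    have "?I N = (\<integral>\<^sup>+y. ennreal (V / ((2 - 2 * s) * (n + 2)) *
        (a s * (n + 2) * (norm (grad v y))\<^sup>2 + b s * ((norm (grad v y))\<^sup>2 * (norm (sgn y))\<^sup>2 + 2 * (sgn y \<bullet> grad v y)\<^sup>2))) \<partial>lborel)"
      using s ab assms(1) by (simp add: N_def W_def n_def V_def nn_integral_linearized_cball)
    \<comment> \<open>\<open>sgn y\<close> has norm 1 except at \<open>y = 0\<close>.\<close>
    also have "\<dots> = (\<integral>\<^sup>+y. ennreal (V / ((2 - 2 * s) * (n + 2)) *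
        ((a s * (n + 2) + b s) * (norm (grad v y))\<^sup>2 + 2 * b s * (sgn y \<bullet> grad v y)\<^sup>2)) \<partial>lborel)"
      by (rule nn_integral_cong_AE, rule eventually_mono[OF AE_lborel_singleton[of 0]])
        (simp add: norm_sgn algebra_simps)
    also have "\<dots> = ennreal (m s)"
      using intP intQ s n V ab
      by (subst nn_integral_eq_integral) (simp_all add: m_def P_def Q_def)
    finally have N: "?I N = ennreal (m s)" .
    have J: "J_frac s \<epsilon> v = ennreal (k s) * ?I G"
      using J_frac_eq_nn_integral_increments[of v s \<epsilon>] ab
      by (simp add: k_def G_def W_def a_def b_def n_def)
    have m: "0 \<le> m s"
      using s n V ab by (simp add: m_def P_def Q_def)
    have E: "0 \<le> (a s + b s) * D"
      using ab D by simp
    have "J_frac s \<epsilon> v \<le> ennreal (k s) * (ennreal (m s) + ennreal ((a s + b s) * D))"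
      unfolding J using upper N by (intro mult_left_mono) auto
    also have "\<dots> = ennreal (k s * m s + k s * ((a s + b s) * D))"
      using k m E by (simp add: distrib_left flip: ennreal_mult ennreal_plus)
    finally have up: "J_frac s \<epsilon> v \<le> ennreal (k s * m s + k s * ((a s + b s) * D))" .
    \<comment> \<open>The error is first added to the energy and then moved across. As it is
      nonnegative, the truncated subtraction is \<open>ennreal\<close> of the real
      difference.\<close>
    have "ennreal (k s * m s) \<le> ennreal (k s) * (?I G + ennreal ((a s + b s) * D))"
      using lower N k m by (simp add: ennreal_mult mult_left_mono)
    also have "\<dots> = J_frac s \<epsilon> v + ennreal (k s * ((a s + b s) * D))"
      unfolding J using k E by (simp add: distrib_left ennreal_mult)
    finally have "ennreal (k s * m s) - ennreal (k s * ((a s + b s) * D)) \<le> J_frac s \<epsilon> v"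
      by (simp add: ennreal_minus_le_iff add.commute)
    then show ?thesis
      using up k E by (simp add: ennreal_minus)
  qed

  have s_near: "\<forall>\<^sub>F s in at_left 1. s \<in> {1/2<..<1::real}"
    by (rule eventually_at_left_real) simp
  have kappa: "((\<lambda>s. kappa CARD('d) s / (1 - s)) \<longlongrightarrow> 2 / V) (at_left 1)"
    unfolding V_def n_def by (rule kappa_asymptotics)
  have a_lim: "(a \<longlongrightarrow> a 1) (at_left 1)" and b_lim: "(b \<longlongrightarrow> b 1) (at_left 1)"
    unfolding a_def b_def by (auto intro!: tendsto_eq_intros)
  \<comment> \<open>The 4 combines the 1/2 in \<open>k\<close> with the 2 in
    \<open>2 - 2 * s\<close>; the remaining factor \<open>1 - s\<close> is moved under
    \<open>kappa\<close>.\<close>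
  have "((\<lambda>s. kappa CARD('d) s / (1 - s) * (V / (4 * (n + 2)) * ((a s * (n + 2) + b s) * P + 2 * b s * Q)))
      \<longlongrightarrow> 2 / V * (V / (4 * (n + 2)) * ((a 1 * (n + 2) + b 1) * P + 2 * b 1 * Q))) (at_left 1)"
    by (rule tendsto_mult[OF kappa]) (intro tendsto_intros a_lim b_lim, simp?)
  also have "2 / V * (V / (4 * (n + 2)) * ((a 1 * (n + 2) + b 1) * P + 2 * b 1 * Q)) =
      1 / 2 * ((1 - \<epsilon>) * P + \<epsilon> * Q)"
  proof -
    \<comment> \<open>The coefficients match here:
      \<open>a 1 * (n + 2) + b 1 = (n + 2) * (1 - \<epsilon>)\<close> and
      \<open>2 * b 1 = (n + 2) * \<epsilon>\<close>.\<close>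
    have e: "(a 1 * (n + 2) + b 1) * P + 2 * b 1 * Q = (n + 2) * ((1 - \<epsilon>) * P + \<epsilon> * Q)"
      by (simp add: a_def b_def field_simps)
    have "2 / V * (V / (4 * N) * (N * X)) = 1 / 2 * X" if "N > 0" for N X :: real
      using V that by (simp add: field_simps)
    then show ?thesis
      unfolding e using n by (metis add_nonneg_pos order_trans zero_le_numeral zero_less_numeral)
  qed
  finally have km: "((\<lambda>s. k s * m s) \<longlongrightarrow> 1 / 2 * ((1 - \<epsilon>) * P + \<epsilon> * Q)) (at_left 1)"
    by (rule Lim_transform_eventually) (rule eventually_mono[OF s_near], simp add: k_def m_def field_simps)
  \<comment> \<open>The error has no \<open>1 / (1 - s)\<close> of its own, so dividing
    \<open>kappa\<close> by \<open>1 - s\<close> leaves a spare factor \<open>1 - s\<close> and the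
    limit is 0.\<close>
  have "((\<lambda>s. kappa CARD('d) s / (1 - s) * ((1 - s) / 2 * ((a s + b s) * D))) \<longlongrightarrow>
      2 / V * ((1 - 1) / 2 * ((a 1 + b 1) * D))) (at_left 1)"
    by (rule tendsto_mult[OF kappa]) (intro tendsto_intros a_lim b_lim, simp?)
  then have kD: "((\<lambda>s. k s * ((a s + b s) * D)) \<longlongrightarrow> 2 / V * ((1 - 1) / 2 * ((a 1 + b 1) * D))) (at_left 1)"
    by (rule Lim_transform_eventually) (rule eventually_mono[OF s_near], simp add: k_def)
  show ?thesis
    unfolding rhs
  proof (rule tendsto_sandwich)
    show "\<forall>\<^sub>F s in at_left 1. ennreal (k s * m s - k s * ((a s + b s) * D)) \<le> J_frac s \<epsilon> v"
      "\<forall>\<^sub>F s in at_left 1. J_frac s \<epsilon> v \<le> ennreal (k s * m s + k s * ((a s + b s) * D))"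
      using bounds by (auto intro: eventually_mono[OF s_near])
    show "((\<lambda>s. ennreal (k s * m s - k s * ((a s + b s) * D))) \<longlongrightarrow> ennreal (1 / 2 * ((1 - \<epsilon>) * P + \<epsilon> * Q))) (at_left 1)"
      using tendsto_ennrealI[OF tendsto_diff[OF km kD]] by simp
    show "((\<lambda>s. ennreal (k s * m s + k s * ((a s + b s) * D))) \<longlongrightarrow> ennreal (1 / 2 * ((1 - \<epsilon>) * P + \<epsilon> * Q))) (at_left 1)"
      using tendsto_ennrealI[OF tendsto_add[OF km kD]] by simp
  qed
qed

end
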